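(* Let $k$ be a number field, $v$ a non-trivial non-Archimedean place of $k$, $k_v$ the completion of $k$ at $v$, $\overline{k}_v$ an algebraic closure of $k_v$, $\gamma \in \overline{k}_v$, $k'$ any subfield of $k_v(\gamma)$, $\overline{k'} \subseteq \overline{k}_v$ the set of elements of $\overline{k}_v$ that are algebraic over $k'$, and $K$ any field extension of $\overline{k'}$. Let $\lambda_1(X), \lambda_2(X), \ldots, \lambda_m(X)$ be polynomials in $K[X] \setminus \{0\}$, and let $\alpha_1, \alpha_2, \ldots, \alpha_m$ be distinct elements of $K \setminus \{0\}$. For $n \in \mathbb{Z}$ put $$S_n = \sum_{i=1}^{m} \lambda_i(n)\, \alpha_i^n .$$ Assume that there is an integer $n_0$ such that $S_n \in k'$ for every $n \geq n_0$. Then $S_n \in k'$ for every $n \in \mathbb{Z}$, and: (i) $\alpha_1, \alpha_2, \ldots, \alpha_m$ are the roots of a polynomial $f(X) \in k'[X]$, so they are in $\overline{k'}$. Moreover, if $|S_n|_v = O(1)$ (as $n \to +\infty$), then $|\alpha_i|_v \leq 1$ for $i = 1, 2, \ldots, m$. (ii) For every $i = 1, 2, \ldots, m$: $k'(\lambda_i) \subseteq k'(\alpha_i)$. (iii) For every automorphism $\sigma \in \operatorname{Gal}(k'(\alpha_1, \ldots, \alpha_m)/k')$ such that $\sigma(\alpha_i) = \alpha_{\pi(i)}$ for $i = 1, \ldots, m$, where $\pi$ is a permutation of $\{1, \ldots, m\}$, we have $\sigma(\lambda_i(X)) = \lambda_{\pi(i)}(X)$ for $i=1,\ldots,m$. (iv)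 If $\lambda_1(X), \ldots, \lambda_m(X)$ are distinct polynomials, then $k'(\alpha_i) = k'(\lambda_i)$ for every $i$.
   Context: $|\cdot|_v$ denotes the absolute value associated with $v$, extended (uniquely) to $\overline{k}_v$. For a polynomial $\lambda_i(X)\in K[X]$, $k'(\lambda_i)$ denotes the field generated over $k'$ by the coefficients of $\lambda_i(X)$. $\operatorname{Gal}(k'(\alpha_1,\ldots,\alpha_m)/k')$ is the group of field automorphisms of $k'(\alpha_1,\ldots,\alpha_m)$ fixing $k'$ elementwise; such a $\sigma$ acts on polynomials coefficientwise: $\sigma(\sum_i a_i X^i) = \sum_i \sigma(a_i) X^i$. *)

theory Defs
  imports
    "HOL-Analysis.Analysis"
    "HOL-Library.Landau_Symbols"
    "HOL-Computational_Algebra.Polynomial"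
    "HOL-Combinatorics.Permutations"
begin

section \<open>Subfields of a field\<close>

definition is_subfield :: "'a::field set \<Rightarrow> bool" where
  "is_subfield F \<longleftrightarrow> 0 \<in> F \<and> 1 \<in> F \<and> (\<forall>x\<in>F. \<forall>y\<in>F. x + y \<in> F \<and> x * y \<in> F)
     \<and> (\<forall>x\<in>F. - x \<in> F \<and> inverse x \<in> F)"

text \<open>The subfield \<open>F(A)\<close>: \<open>hull\<close> is the intersection of all subfields containing the given set.\<close>

definition adjoin :: "'a::field set \<Rightarrow> 'a set \<Rightarrow> 'a set" where
  "adjoin F A = is_subfield hull (F \<union> A)"

text \<open>The field generated over \<open>F\<close> by the coefficients of \<open>p\<close>.\<close>

definition adjoin_coeffs :: "'a::field set \<Rightarrow> 'a poly \<Rightarrow> 'a set" where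
  "adjoin_coeffs F p = adjoin F (range (coeff p))"

definition polys_over :: "'a::field set \<Rightarrow> 'a poly set" where
  "polys_over F = {p. \<forall>i. coeff p i \<in> F}"

definition algebraic_elements :: "'a::field set \<Rightarrow> 'a set" where
  "algebraic_elements F = {x. \<exists>p\<in>polys_over F. p \<noteq> 0 \<and> poly p x = 0}"

text \<open>A subfield of finite degree over the field of rationals.\<close>

definition number_field :: "'a::field_char_0 set \<Rightarrow> bool" where
  "number_field k \<longleftrightarrow> is_subfield k \<and>
     (\<exists>B. finite B \<and> k = module.span (\<lambda>(q::rat) x. of_rat q * x) B)"

text \<open>Homomorphisms are only constrained on their domain \<open>F\<close>; values outside \<open>F\<close> are irrelevant.
  As \<open>1\<close> is preserved, a homomorphism on a subfield is injective there.\<close>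

definition field_hom_on :: "'a::field set \<Rightarrow> ('a \<Rightarrow> 'b::field) \<Rightarrow> bool" where
  "field_hom_on F h \<longleftrightarrow> h 1 = 1 \<and>
     (\<forall>x\<in>F. \<forall>y\<in>F. h (x + y) = h x + h y \<and> h (x * y) = h x * h y)"

definition Gal :: "'a::field set \<Rightarrow> 'a set \<Rightarrow> ('a \<Rightarrow> 'a) set" where
  "Gal L F = {\<sigma>. bij_betw \<sigma> L L \<and> field_hom_on L \<sigma> \<and> (\<forall>x\<in>F. \<sigma> x = x)}"

section \<open>Absolute values\<close>

definition absolute_value :: "('a::field \<Rightarrow> real) \<Rightarrow> bool" where
  "absolute_value v \<longleftrightarrow> (\<forall>x. v x \<ge> 0) \<and> (\<forall>x. v x = 0 \<longleftrightarrow> x = 0)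
     \<and> (\<forall>x y. v (x * y) = v x * v y) \<and> (\<forall>x y. v (x + y) \<le> v x + v y)"

definition nontrivial_on :: "'a::field set \<Rightarrow> ('a \<Rightarrow> real) \<Rightarrow> bool" where
  "nontrivial_on k v \<longleftrightarrow> (\<exists>x\<in>k. x \<noteq> 0 \<and> v x \<noteq> 1)"

definition nonarchimedean_on :: "'a::field set \<Rightarrow> ('a \<Rightarrow> real) \<Rightarrow> bool" where
  "nonarchimedean_on k v \<longleftrightarrow> (\<forall>x\<in>k. \<forall>y\<in>k. v (x + y) \<le> max (v x) (v y))"

text \<open>\<open>kv\<close> is a completion of \<open>k\<close>: a complete field containing \<open>k\<close> as a dense subfield,
  with respect to the metric \<open>v (x - y)\<close>.\<close>

definition is_completion :: "('a::field \<Rightarrow> real) \<Rightarrow> 'a set \<Rightarrow> 'a set \<Rightarrow> bool" where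
  "is_completion v k kv \<longleftrightarrow> is_subfield kv \<and> k \<subseteq> kv
     \<and> Metric_space.mtopology kv (\<lambda>x y. v (x - y)) closure_of k = kv
     \<and> Metric_space.mcomplete kv (\<lambda>x y. v (x - y))"

text \<open>The ambient type, being algebraically closed, is an algebraic closure of \<open>kv\<close> as soon as
  it is algebraic over \<open>kv\<close>. The function \<open>v\<close> is at once an absolute value in the given place
  of \<open>k\<close> and its extension to \<open>kv\<close> and to the algebraic closure.\<close>

definition completion_setting ::
  "'a::{alg_closed_field,field_char_0} set \<Rightarrow> ('a \<Rightarrow> real) \<Rightarrow> 'a set \<Rightarrow> bool" where
  "completion_setting k v kv \<longleftrightarrow> number_field k \<and> absolute_value v
     \<and> nontrivial_on k v \<and> nonarchimedean_on k v
     \<and> is_completion v k kv \<and> algebraic_elements kv = UNIV"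

end

theory Submission
  imports Defs
begin

text \<open>
Let \<open>F = \<iota> ` k'\<close>, a subfield of \<open>K\<close>. Polynomials act on sequences by letting \<open>X\<close> be the
shift \<open>n \<mapsto> n + 1\<close>. In characteristic zero the term \<open>\<lambda>\<^sub>i(n) \<alpha>\<^sub>i\<^sup>n\<close> is killed by
\<open>p\<close> exactly when \<open>(X - \<alpha>\<^sub>i)\<close> divides \<open>p\<close> to the power \<open>1 + deg \<lambda>\<^sub>i\<close>, so the annihilator of the
whole sequence is generated by \<open>f = \<Prod>\<^sub>i (X - \<alpha>\<^sub>i)\<close> with these exponents.

The coefficients of a monic annihilator of the degree of \<open>f\<close> solve a linear system whose entries
are values \<open>S\<^sub>n \<in> F\<close>. Since a system over \<open>F\<close> that is solvable in \<open>K\<close> is solvable in \<open>F\<close>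
(\<open>linear_system_solvable_in_subfield\<close>) and \<open>f\<close> is the only solution, \<open>f \<in> F[X]\<close>. Running the
recurrence \<open>f\<close> backwards, which is possible as \<open>f(0) \<noteq> 0\<close>, gives \<open>S\<^sub>n \<in> F\<close> for all \<open>n\<close>, and
the \<open>\<alpha>\<^sub>i\<close> are algebraic as roots of \<open>f\<close>.

Parts (ii) to (iv) all come from one argument, carried out in \<open>lam_over_subfield\<close> and
\<open>embedding_permutes_terms\<close>: if a subfield \<open>L \<supseteq> F\<close> contains \<open>\<alpha>\<^sub>i\<close>, then \<open>\<lambda>\<^sub>i \<in> L[X]\<close>, and every homomorphism \<open>\<tau>\<close> from \<open>L\<close> to \<open>K\<close> over \<open>F\<close> takes the pair
\<open>(\<alpha>\<^sub>i, \<lambda>\<^sub>i)\<close> to some pair \<open>(\<alpha>\<^sub>j, \<lambda>\<^sub>j)\<close>. Indeed the cofactor of \<open>X - \<alpha>\<^sub>i\<close> in \<open>f\<close> isolates the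
\<open>i\<close>-th term of \<open>S\<close>, has coefficients in \<open>L\<close>, and is mapped to the cofactor of \<open>X - \<alpha>\<^sub>j\<close>. For
(ii) take \<open>L = F(\<alpha>\<^sub>i)\<close>, and for (iii) take \<open>\<tau>\<close> to be the given automorphism. For (iv) let \<open>M\<close> be
\<open>F(\<lambda>\<^sub>i)\<close>; if \<open>\<alpha>\<^sub>i \<notin> M\<close>, a homomorphism from \<open>M(\<alpha>\<^sub>i)\<close> over \<open>M\<close> moves \<open>\<alpha>\<^sub>i\<close> to another root of
\<open>f\<close> (\<open>nontrivial_embedding\<close>) but fixes \<open>\<lambda>\<^sub>i\<close>, which contradicts the distinctness of the \<open>\<lambda>\<^sub>j\<close>.

For the bound in (i), multiplying the cofactor of \<open>\<alpha>\<^sub>i\<close> by \<open>X - \<alpha>\<^sub>i\<close> to the power \<open>deg \<lambda>\<^sub>i\<close> turns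
the bounded sequence \<open>S\<close> into the bounded sequence \<open>c \<alpha>\<^sub>i\<^sup>n\<close> with \<open>c \<noteq> 0\<close>.
\<close>

section \<open>Subfields, homomorphisms and polynomials over a subfield\<close>

named_theorems subfield_closed

lemma subfield_zero [subfield_closed]: "is_subfield F \<Longrightarrow> 0 \<in> F"
  and subfield_one [subfield_closed]: "is_subfield F \<Longrightarrow> 1 \<in> F"
  and subfield_add [subfield_closed]: "is_subfield F \<Longrightarrow> x \<in> F \<Longrightarrow> y \<in> F \<Longrightarrow> x + y \<in> F"
  and subfield_mult [subfield_closed]: "is_subfield F \<Longrightarrow> x \<in> F \<Longrightarrow> y \<in> F \<Longrightarrow> x * y \<in> F"
  and subfield_uminus [subfield_closed]: "is_subfield F \<Longrightarrow> x \<in> F \<Longrightarrow> - x \<in> F"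
  and subfield_inverse [subfield_closed]: "is_subfield F \<Longrightarrow> x \<in> F \<Longrightarrow> inverse x \<in> F"
  by (simp_all add: is_subfield_def)

lemma subfield_diff [subfield_closed]: "is_subfield F \<Longrightarrow> x \<in> F \<Longrightarrow> y \<in> F \<Longrightarrow> x - y \<in> F"
  using subfield_add[of F x "- y"] subfield_uminus[of F y] by simp

lemma subfield_divide [subfield_closed]: "is_subfield F \<Longrightarrow> x \<in> F \<Longrightarrow> y \<in> F \<Longrightarrow> x / y \<in> F"
  by (simp add: divide_inverse subfield_closed)

lemma subfield_power [subfield_closed]: "is_subfield F \<Longrightarrow> x \<in> F \<Longrightarrow> x ^ n \<in> F"
  by (induction n) (auto intro: subfield_closed)

lemma subfield_powi [subfield_closed]: "is_subfield F \<Longrightarrow> x \<in> F \<Longrightarrow> x powi n \<in> F"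
  by (simp add: power_int_def subfield_closed)

lemma subfield_of_nat [subfield_closed]: "is_subfield F \<Longrightarrow> of_nat n \<in> F"
  by (induction n) (auto intro: subfield_closed)

lemma subfield_of_int [subfield_closed]: "is_subfield F \<Longrightarrow> of_int n \<in> F"
  by (cases n) (auto intro!: subfield_closed simp del: of_nat_Suc)

lemma subfield_sum [subfield_closed]:
  "is_subfield F \<Longrightarrow> (\<And>i. i \<in> A \<Longrightarrow> f i \<in> F) \<Longrightarrow> sum f A \<in> F"
  by (induction A rule: infinite_finite_induct) (auto intro: subfield_closed)

lemma is_subfield_adjoin: "is_subfield (adjoin F A)"
  unfolding adjoin_def by (rule hull_in) (auto simp: is_subfield_def)

lemma adjoin_base: "F \<subseteq> adjoin F A" and adjoin_gens: "A \<subseteq> adjoin F A"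
  using hull_subset[of "F \<union> A" is_subfield] by (auto simp: adjoin_def)

lemma adjoin_least: "is_subfield L \<Longrightarrow> F \<subseteq> L \<Longrightarrow> A \<subseteq> L \<Longrightarrow> adjoin F A \<subseteq> L"
  by (simp add: adjoin_def hull_minimal)

lemma polys_overI: "(\<And>i. coeff p i \<in> F) \<Longrightarrow> p \<in> polys_over F"
  and polys_overD: "p \<in> polys_over F \<Longrightarrow> coeff p i \<in> F"
  by (simp_all add: polys_over_def)

lemma polys_over_mono: "F \<subseteq> L \<Longrightarrow> p \<in> polys_over F \<Longrightarrow> p \<in> polys_over L"
  by (auto simp: polys_over_def)

context
  fixes F :: "'a::field set"
  assumes F: "is_subfield F"
begin

lemma polys_over_0: "0 \<in> polys_over F"
  and polys_over_1: "1 \<in> polys_over F"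
  and polys_over_pCons: "a \<in> F \<Longrightarrow> p \<in> polys_over F \<Longrightarrow> pCons a p \<in> polys_over F"
  and polys_over_monom: "a \<in> F \<Longrightarrow> monom a n \<in> polys_over F"
  and polys_over_smult: "a \<in> F \<Longrightarrow> p \<in> polys_over F \<Longrightarrow> smult a p \<in> polys_over F"
  and polys_over_add: "p \<in> polys_over F \<Longrightarrow> q \<in> polys_over F \<Longrightarrow> p + q \<in> polys_over F"
  and polys_over_diff: "p \<in> polys_over F \<Longrightarrow> q \<in> polys_over F \<Longrightarrow> p - q \<in> polys_over F"
  and polys_over_uminus: "p \<in> polys_over F \<Longrightarrow> - p \<in> polys_over F"
  and polys_over_mult: "p \<in> polys_over F \<Longrightarrow> q \<in> polys_over F \<Longrightarrow> p * q \<in> polys_over F"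
  using F by (auto simp: polys_over_def coeff_pCons coeff_mult intro!: subfield_closed split: nat.split)

lemma polys_over_power: "p \<in> polys_over F \<Longrightarrow> p ^ n \<in> polys_over F"
  by (induction n) (auto intro: polys_over_1 polys_over_mult)

lemma polys_over_linear_power: "a \<in> F \<Longrightarrow> [:- a, 1:] ^ n \<in> polys_over F"
  by (intro polys_over_power polys_over_pCons polys_over_0 subfield_uminus[OF F] subfield_one[OF F])

lemma polys_over_sum: "(\<And>i. i \<in> A \<Longrightarrow> f i \<in> polys_over F) \<Longrightarrow> sum f A \<in> polys_over F"
  by (induction A rule: infinite_finite_induct) (auto intro: polys_over_0 polys_over_add)

lemma poly_in_subfield: "p \<in> polys_over F \<Longrightarrow> x \<in> F \<Longrightarrow> poly p x \<in> F"
  using F by (auto simp: poly_altdef intro!: subfield_closed dest: polys_overD)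

lemma polys_over_division:
  assumes "p \<in> polys_over F" "q \<in> polys_over F" "q \<noteq> 0"
  shows "\<exists>s\<in>polys_over F. \<exists>t\<in>polys_over F. p = q * s + t \<and> (t = 0 \<or> degree t < degree q)"
  using assms(1)
proof (induction "degree p" arbitrary: p rule: less_induct)
  case less
  show ?case
  proof (cases "p = 0 \<or> degree p < degree q")
    case True
    with less.prems show ?thesis by (intro bexI[of _ 0] bexI[of _ p]) (auto intro: polys_over_0)
  next
    case False
    \<comment> \<open>One step of long division: \<open>q * u\<close> has the leading term of \<open>p\<close>.\<close>
    define u where "u = monom (lead_coeff p / lead_coeff q) (degree p - degree q)"
    define p' where "p' = p - q * u"
    have u: "u \<in> polys_over F" unfolding u_def
      using less.prems assms F by (intro polys_over_monom subfield_closed) (auto dest: polys_overD)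
    have p': "p' \<in> polys_over F" unfolding p'_def
      using u less.prems assms by (intro polys_over_diff polys_over_mult)
    have nz: "lead_coeff p / lead_coeff q \<noteq> 0" using False assms by auto
    have deg: "degree (q * u) = degree p"
      using False assms nz by (simp add: u_def degree_mult_eq degree_monom_eq monom_eq_0_iff)
    have lc: "lead_coeff (q * u) = lead_coeff p"
    proof -
      have "lead_coeff u = lead_coeff p / lead_coeff q" unfolding u_def by (rule lead_coeff_monom)
      with assms show ?thesis by (simp add: lead_coeff_mult del: lead_coeff_monom)
    qed
    show ?thesis
    proof (cases "p' = 0")
      case True
      with u show ?thesis by (intro bexI[of _ u] bexI[of _ 0]) (auto simp: p'_def intro: polys_over_0)
    next
      case nz': False
      have "degree p' < degree p"
      proof (rule ccontr)
        assume "\<not> ?thesis"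
        moreover have "degree p' \<le> degree p" unfolding p'_def using deg by (intro degree_diff_le) auto
        ultimately have "lead_coeff p' = 0" using deg lc by (simp add: p'_def)
        with nz' show False by simp
      qed
      from less.hyps[OF this p'] obtain s t where st: "s \<in> polys_over F" "t \<in> polys_over F"
        "p' = q * s + t" "t = 0 \<or> degree t < degree q" by blast
      have "p = q * (s + u) + t" using st(3) by (simp add: p'_def algebra_simps)
      with st u show ?thesis by (intro bexI[of _ "s + u"] bexI[of _ t]) (auto intro: polys_over_add)
    qed
  qed
qed

text \<open>A quotient that exists in \<open>K[X]\<close> has coefficients in \<open>F\<close>, because division with remainder can be
carried out in \<open>F[X]\<close> and its result is unique in \<open>K[X]\<close>.\<close>

lemma polys_over_cancel_factor:
  assumes "q \<in> polys_over F" "q \<noteq> 0" "q * g \<in> polys_over F"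
  shows "g \<in> polys_over F"
proof -
  obtain s t where st: "s \<in> polys_over F" "q * g = q * s + t" "t = 0 \<or> degree t < degree q"
    using polys_over_division[OF assms(3) assms(1,2)] by blast
  have "t = q * (g - s)" using st(2) by (simp add: algebra_simps)
  with st(3) assms(2) have "g = s" by (cases "g = s") (auto simp: degree_mult_eq)
  with st show ?thesis by simp
qed

lemma subfield_elem_algebraic: "x \<in> F \<Longrightarrow> x \<in> algebraic_elements F"
  unfolding algebraic_elements_def using F
  by (auto intro!: bexI[of _ "[:-x, 1:]"] polys_over_pCons polys_over_0 subfield_closed)

end

subsection \<open>Homomorphisms\<close>

locale subfield_hom =
  fixes L :: "'a::field set" and h :: "'a \<Rightarrow> 'b::field"
  assumes subfield: "is_subfield L" and hom: "field_hom_on L h"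
begin

lemma hom_one: "h 1 = 1"
  and hom_add: "x \<in> L \<Longrightarrow> y \<in> L \<Longrightarrow> h (x + y) = h x + h y"
  and hom_mult: "x \<in> L \<Longrightarrow> y \<in> L \<Longrightarrow> h (x * y) = h x * h y"
  using hom by (auto simp: field_hom_on_def)

lemma hom_zero: "h 0 = 0"
  by (metis add.right_neutral add_left_cancel hom_add subfield subfield_zero)

lemma hom_uminus: "x \<in> L \<Longrightarrow> h (- x) = - h x"
  using hom_add[of x "- x"] subfield by (simp add: subfield_closed hom_zero add_eq_0_iff)

lemma hom_diff: "x \<in> L \<Longrightarrow> y \<in> L \<Longrightarrow> h (x - y) = h x - h y"
  using hom_add[of x "- y"] hom_uminus[of y] subfield by (simp add: subfield_closed)

lemma hom_eq_0_iff: "x \<in> L \<Longrightarrow> h x = 0 \<longleftrightarrow> x = 0"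
  using hom_mult[of x "inverse x"] subfield
  by (cases "x = 0") (auto simp: hom_zero hom_one subfield_closed)

lemma hom_inverse: "x \<in> L \<Longrightarrow> h (inverse x) = inverse (h x)"
  using hom_mult[of x "inverse x"] subfield
  by (cases "x = 0") (auto simp: hom_zero hom_one subfield_closed intro!: inverse_unique[symmetric])

lemma hom_inj: "inj_on h L"
  using hom_diff hom_eq_0_iff subfield by (intro inj_onI) (metis eq_iff_diff_eq_0 subfield_diff)

lemma hom_power: "x \<in> L \<Longrightarrow> h (x ^ n) = h x ^ n"
  using subfield by (induction n) (auto simp: hom_one hom_mult subfield_closed)

lemma hom_powi: "x \<in> L \<Longrightarrow> h (x powi n) = h x powi n"
  using subfield by (auto simp: power_int_def hom_power hom_inverse subfield_closed)

lemma hom_of_nat: "h (of_nat n) = of_nat n"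
  using subfield by (induction n) (auto simp: hom_zero hom_one hom_add subfield_closed)

lemma hom_of_int: "h (of_int n) = of_int n"
  using subfield
  by (cases n) (auto simp: hom_of_nat hom_uminus subfield_closed simp del: of_nat_Suc)

lemma hom_sum: "(\<And>i. i \<in> A \<Longrightarrow> f i \<in> L) \<Longrightarrow> h (sum f A) = (\<Sum>i\<in>A. h (f i))"
  using subfield by (induction A rule: infinite_finite_induct) (auto simp: hom_zero hom_add subfield_closed)

lemma coeff_map_hom: "coeff (map_poly h p) n = h (coeff p n)"
  by (simp add: coeff_map_poly hom_zero)

lemma degree_map_hom: "p \<in> polys_over L \<Longrightarrow> degree (map_poly h p) = degree p"
  by (cases "p = 0") (auto simp: polys_over_def hom_eq_0_iff intro!: map_poly_degree_eq)

lemma map_hom_mult: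
  "p \<in> polys_over L \<Longrightarrow> q \<in> polys_over L \<Longrightarrow> map_poly h (p * q) = map_poly h p * map_poly h q"
  using subfield
  by (intro poly_eqI)
    (auto simp: coeff_map_hom coeff_mult hom_sum hom_mult polys_over_def subfield_closed)

lemma map_hom_pCons: "map_poly h (pCons a p) = pCons (h a) (map_poly h p)"
  by (intro poly_eqI) (simp add: coeff_map_hom coeff_pCons split: nat.split)

lemma map_hom_linear: "a \<in> L \<Longrightarrow> map_poly h [:- a, 1:] = [:- h a, 1:]"
  by (simp add: map_hom_pCons hom_one hom_uminus)

lemma map_hom_power: "p \<in> polys_over L \<Longrightarrow> map_poly h (p ^ n) = map_poly h p ^ n"
  using subfield
  by (induction n) (auto simp: map_hom_mult polys_over_power map_poly_1' hom_one)

lemma poly_map_hom: "p \<in> polys_over L \<Longrightarrow> x \<in> L \<Longrightarrow> poly (map_poly h p) (h x) = h (poly p x)"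
  using subfield
  by (auto simp: poly_altdef degree_map_hom coeff_map_hom hom_sum hom_mult hom_power polys_over_def
      subfield_closed)

lemma is_subfield_image: "is_subfield F \<Longrightarrow> F \<subseteq> L \<Longrightarrow> is_subfield (h ` F)"
  unfolding is_subfield_def
  by (auto simp: subset_iff hom_add[symmetric] hom_mult[symmetric] hom_inverse[symmetric]
      hom_uminus[symmetric])
    (metis hom_zero image_eqI, metis hom_one image_eqI)

end

section \<open>Linear algebra over a subfield\<close>

text \<open>Gaussian elimination on the unknowns, as it never leaves \<open>F\<close>. The set \<open>R\<close> of equations may be
infinite; below there is one equation for every \<open>n \<ge> n0\<close>.\<close>

lemma linear_system_solvable_in_subfield:
  fixes a :: "'r \<Rightarrow> 'k \<Rightarrow> 'a::field"
  assumes F: "is_subfield F" and "finite J"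
    and "\<And>r k. r \<in> R \<Longrightarrow> k \<in> J \<Longrightarrow> a r k \<in> F" and "\<And>r. r \<in> R \<Longrightarrow> b r \<in> F"
    and "\<And>r. r \<in> R \<Longrightarrow> (\<Sum>k\<in>J. a r k * c k) = b r"
  shows "\<exists>c'. (\<forall>k\<in>J. c' k \<in> F) \<and> (\<forall>r\<in>R. (\<Sum>k\<in>J. a r k * c' k) = b r)"
  using assms(2-)
proof (induction J arbitrary: a b)
  case empty
  then show ?case by simp
next
  case (insert j J)
  show ?case
  proof (cases "\<forall>r\<in>R. a r j = 0")
    case True
    have "\<exists>c'. (\<forall>k\<in>J. c' k \<in> F) \<and> (\<forall>r\<in>R. (\<Sum>k\<in>J. a r k * c' k) = b r)"
      using insert.prems insert.hyps True by (intro insert.IH) auto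
    then obtain c' where c': "\<forall>k\<in>J. c' k \<in> F" "\<forall>r\<in>R. (\<Sum>k\<in>J. a r k * c' k) = b r"
      by blast
    have "(\<Sum>k\<in>J. a r k * (c'(j := 0)) k) = (\<Sum>k\<in>J. a r k * c' k)" for r
      using insert.hyps by (intro sum.cong) auto
    with c' F insert.hyps True show ?thesis
      by (intro exI[of _ "c'(j := 0)"]) (auto intro: subfield_closed)
  next
    case False
    then obtain p where p: "p \<in> R" "a p j \<noteq> 0" by blast
    \<comment> \<open>Row \<open>p\<close> is the pivot: subtracting \<open>t r\<close> times it from row \<open>r\<close> eliminates the unknown \<open>j\<close>.\<close>
    define t where "t r = a r j / a p j" for r
    define a' where "a' r k = a r k - t r * a p k" for r k
    define b' where "b' r = b r - t r * b p" for r
    have t: "t r \<in> F" if "r \<in> R" for r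
      using that p insert.prems(1) F by (auto simp: t_def intro!: subfield_closed)
    have elim: "(\<Sum>k\<in>J. a' r k * d k) = (\<Sum>k\<in>J. a r k * d k) - t r * (\<Sum>k\<in>J. a p k * d k)" for r d
      by (simp add: a'_def algebra_simps sum_subtractf sum_distrib_left)
    have "\<exists>c'. (\<forall>k\<in>J. c' k \<in> F) \<and> (\<forall>r\<in>R. (\<Sum>k\<in>J. a' r k * c' k) = b' r)"
    proof (rule insert.IH)
      show "a' r k \<in> F" if "r \<in> R" "k \<in> J" for r k
        using that p t insert.prems(1) F by (auto simp: a'_def intro!: subfield_closed)
      show "b' r \<in> F" if "r \<in> R" for r
        using that p t insert.prems(2) F by (auto simp: b'_def intro!: subfield_closed)
      show "(\<Sum>k\<in>J. a' r k * c k) = b' r" if "r \<in> R" for r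
      proof -
        have "(\<Sum>k\<in>J. a r k * c k) = b r - a r j * c j" if "r \<in> R" for r
          using insert.prems(3)[OF that] insert.hyps by (simp add: algebra_simps)
        from this[OF that] this[OF p(1)]
        have "(\<Sum>k\<in>J. a' r k * c k) = b r - a r j * c j - t r * (b p - a p j * c j)"
          unfolding elim by simp
        moreover have "a r j = t r * a p j" using p by (simp add: t_def)
        ultimately show ?thesis by (simp add: b'_def algebra_simps)
      qed
    qed
    then obtain c' where c': "\<forall>k\<in>J. c' k \<in> F" "\<forall>r\<in>R. (\<Sum>k\<in>J. a' r k * c' k) = b' r"
      by blast
    define x where "x = (b p - (\<Sum>k\<in>J. a p k * c' k)) / a p j"
    have x: "x \<in> F" using p c' insert.prems F by (auto simp: x_def intro!: subfield_closed)
    have "(\<Sum>k\<in>J. a r k * (c'(j := x)) k) = (\<Sum>k\<in>J. a r k * c' k)" for r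
      using insert.hyps by (intro sum.cong) auto
    moreover have "a r j * x + (\<Sum>k\<in>J. a r k * c' k) = b r" if "r \<in> R" for r
    proof -
      have "a r j * x = t r * (b p - (\<Sum>k\<in>J. a p k * c' k))"
        using p by (simp add: x_def t_def)
      moreover have "(\<Sum>k\<in>J. a r k * c' k) = b' r + t r * (\<Sum>k\<in>J. a p k * c' k)"
        using c'(2) that elim[of r c'] by simp
      ultimately have "a r j * x + (\<Sum>k\<in>J. a r k * c' k) =
          t r * (b p - (\<Sum>k\<in>J. a p k * c' k)) + (b' r + t r * (\<Sum>k\<in>J. a p k * c' k))"
        by (simp only:)
      then show ?thesis by (simp add: b'_def algebra_simps)
    qed
    ultimately show ?thesis using c' x insert.hyps
      by (intro exI[of _ "c'(j := x)"]) auto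
  qed
qed

text \<open>More vectors than spanning elements: eliminate the spanning element \<open>j\<close> at the cost of one vector
\<open>x p\<close>.\<close>

lemma dependent_over_subfield:
  fixes x :: "'i \<Rightarrow> 'a::field" and e :: "'j \<Rightarrow> 'a"
  assumes F: "is_subfield F" and "finite J" "finite I" "card J < card I"
    and "\<And>k j. k \<in> I \<Longrightarrow> j \<in> J \<Longrightarrow> a k j \<in> F"
    and "\<And>k. k \<in> I \<Longrightarrow> x k = (\<Sum>j\<in>J. a k j * e j)"
  shows "\<exists>c. (\<forall>k\<in>I. c k \<in> F) \<and> (\<exists>k\<in>I. c k \<noteq> 0) \<and> (\<Sum>k\<in>I. c k * x k) = 0"
  using assms(2-)
proof (induction J arbitrary: I x a)
  case empty
  then have "I \<noteq> {}" by auto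
  with empty show ?case using F by (intro exI[of _ "\<lambda>_. 1"]) (auto intro: subfield_closed)
next
  case (insert j J)
  show ?case
  proof (cases "\<forall>k\<in>I. a k j = 0")
    case True
    with insert.prems insert.hyps show ?thesis by (intro insert.IH[of I a x]) auto
  next
    case False
    then obtain p where p: "p \<in> I" "a p j \<noteq> 0" by blast
    define I' where "I' = I - {p}"
    define t where "t k = a k j / a p j" for k
    have I: "I = insert p I'" "p \<notin> I'" "finite I'" using p insert.prems(1) by (auto simp: I'_def)
    have t: "t k \<in> F" if "k \<in> I" for k
      using that p insert.prems(3) F by (auto simp: t_def intro!: subfield_closed)
    have "\<exists>c. (\<forall>k\<in>I'. c k \<in> F) \<and> (\<exists>k\<in>I'. c k \<noteq> 0) \<and> (\<Sum>k\<in>I'. c k * (x k - t k * x p)) = 0"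
    proof (rule insert.IH[where a = "\<lambda>k i. a k i - t k * a p i"])
      show "card J < card I'" using insert I by auto
      show "a k i - t k * a p i \<in> F" if "k \<in> I'" "i \<in> J" for k i
        using that p t insert.prems(3) F I by (auto intro!: subfield_closed)
      show "x k - t k * x p = (\<Sum>i\<in>J. (a k i - t k * a p i) * e i)" if "k \<in> I'" for k
      proof -
        have "x k = a k j * e j + (\<Sum>i\<in>J. a k i * e i)" "x p = a p j * e j + (\<Sum>i\<in>J. a p i * e i)"
          using insert.prems(4)[of k] insert.prems(4)[of p] that insert.hyps I by auto
        moreover have "a k j = t k * a p j" using p by (simp add: t_def)
        ultimately show ?thesis
          by (simp add: algebra_simps sum_subtractf sum_distrib_left)
      qed
    qed (use I in auto)
    then obtain c where c: "\<forall>k\<in>I'. c k \<in> F" "\<exists>k\<in>I'. c k \<noteq> 0"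
      "(\<Sum>k\<in>I'. c k * (x k - t k * x p)) = 0" by blast
    define y where "y = - (\<Sum>k\<in>I'. c k * t k)"
    have y: "y \<in> F" using c t F I by (auto simp: y_def intro!: subfield_closed)
    have "(\<Sum>k\<in>I'. (c(p := y)) k * x k) = (\<Sum>k\<in>I'. c k * x k)"
      using I by (intro sum.cong) auto
    moreover have "(\<Sum>k\<in>I'. c k * x k) + y * x p = 0"
      using c(3) by (simp add: y_def algebra_simps sum_subtractf sum_distrib_left)
    ultimately show ?thesis using c y I
      by (intro exI[of _ "c(p := y)"]) (auto simp: add.commute)
  qed
qed

section \<open>Algebraic elements\<close>

text \<open>An element is algebraic if all its powers lie in one \<open>F\<close>-space of finite dimension, since then
\<open>card J + 1\<close> of them are dependent.\<close>

lemma algebraic_elementsI: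
  assumes F: "is_subfield F" and "finite J"
    and span: "\<And>n. \<exists>a. (\<forall>j\<in>J. a j \<in> F) \<and> z ^ n = (\<Sum>j\<in>J. a j * e j)"
  shows "z \<in> algebraic_elements F"
proof -
  from span obtain a where a: "\<And>n j. j \<in> J \<Longrightarrow> a n j \<in> F" "\<And>n. z ^ n = (\<Sum>j\<in>J. a n j * e j)"
    by metis
  have "\<exists>c. (\<forall>k\<in>{..card J}. c k \<in> F) \<and> (\<exists>k\<in>{..card J}. c k \<noteq> 0) \<and> (\<Sum>k\<le>card J. c k * z ^ k) = 0"
    by (rule dependent_over_subfield[OF F \<open>finite J\<close>, where a = a and e = e]) (use a in auto)
  then obtain c where c: "\<forall>k\<le>card J. c k \<in> F" "\<exists>k\<le>card J. c k \<noteq> 0"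
    "(\<Sum>k\<le>card J. c k * z ^ k) = 0" by auto
  define p where "p = (\<Sum>k\<le>card J. monom (c k) k)"
  have "coeff p k = (if k \<le> card J then c k else 0)" for k
    by (simp add: p_def coeff_sum)
  then have "p \<in> polys_over F" "p \<noteq> 0"
    using c F by (auto intro!: polys_overI subfield_closed simp: poly_eq_iff)
  moreover have "poly p z = 0" using c by (simp add: p_def poly_sum poly_monom)
  ultimately show ?thesis by (auto simp: algebraic_elements_def)
qed

lemma power_in_bounded_span:
  assumes F: "is_subfield F" and "x \<in> algebraic_elements F"
  shows "\<exists>D. \<forall>n. \<exists>a. (\<forall>i. a i \<in> F) \<and> x ^ n = (\<Sum>i<D. a i * x ^ i)"
proof -
  obtain p where p: "p \<in> polys_over F" "p \<noteq> 0" "poly p x = 0"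
    using assms by (auto simp: algebraic_elements_def)
  have "degree p > 0" using p by (intro Nat.gr0I) (auto elim: degree_eq_zeroE)
  have "\<exists>a. (\<forall>i. a i \<in> F) \<and> x ^ n = (\<Sum>i<degree p. a i * x ^ i)" for n
  proof -
    obtain s t where st: "t \<in> polys_over F" "monom 1 n = p * s + t" "t = 0 \<or> degree t < degree p"
      using polys_over_division[OF F polys_over_monom[OF F subfield_one[OF F]] p(1,2)] by blast
    have "x ^ n = poly t x"
      using arg_cong[OF st(2), of "\<lambda>q. poly q x"] p(3) by (simp add: poly_monom)
    also have "\<dots> = (\<Sum>i<degree p. coeff t i * x ^ i)" unfolding poly_altdef
      using st(3) \<open>degree p > 0\<close> by (intro sum.mono_neutral_cong_left) (auto simp: coeff_eq_0)
    finally show ?thesis using st(1) by (auto intro!: exI[of _ "coeff t"] dest: polys_overD)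
  qed
  then show ?thesis by blast
qed

text \<open>Sums and products: all \<open>x ^ n * y ^ l\<close> lie in the finite-dimensional span \<open>V\<close> of those with small
exponents, hence so do the powers of \<open>x + y\<close> and \<open>x * y\<close>. Inverses: reverse the polynomial.\<close>

lemma is_subfield_algebraic_elements:
  fixes F :: "'a::field set"
  assumes F: "is_subfield F"
  shows "is_subfield (algebraic_elements F)"
proof -
  let ?A = "algebraic_elements F"
  have sum_prod: "x + y \<in> ?A \<and> x * y \<in> ?A" if xy: "x \<in> ?A" "y \<in> ?A" for x y
  proof -
    obtain D where D: "\<And>n. \<exists>a. (\<forall>i. a i \<in> F) \<and> x ^ n = (\<Sum>i<D. a i * x ^ i)"
      using power_in_bounded_span[OF F xy(1)] by blast
    obtain E where E: "\<And>n. \<exists>a. (\<forall>i. a i \<in> F) \<and> y ^ n = (\<Sum>i<E. a i * y ^ i)"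
      using power_in_bounded_span[OF F xy(2)] by blast
    define J where "J = {..<D} \<times> {..<E}"
    define e where "e = (\<lambda>(i, j). x ^ i * y ^ j)"
    define V where "V = {z. \<exists>a. (\<forall>j\<in>J. a j \<in> F) \<and> z = (\<Sum>j\<in>J. a j * e j)}"
    have V_mono: "x ^ n * y ^ l \<in> V" for n l
    proof -
      obtain a where a: "\<And>i. a i \<in> F" "x ^ n = (\<Sum>i<D. a i * x ^ i)" using D[of n] by blast
      obtain b where b: "\<And>i. b i \<in> F" "y ^ l = (\<Sum>i<E. b i * y ^ i)" using E[of l] by blast
      have "x ^ n * y ^ l = (\<Sum>j\<in>J. (case j of (i, k) \<Rightarrow> a i * b k) * e j)"
        unfolding a(2) b(2) sum_product J_def sum.cartesian_product e_def
        by (intro sum.cong) (auto simp: mult_ac)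
      then show ?thesis unfolding V_def using a(1) b(1) F
        by (intro CollectI exI[of _ "\<lambda>(i, k). a i * b k"]) (auto intro: subfield_closed)
    qed
    have V_add: "u + w \<in> V" if "u \<in> V" "w \<in> V" for u w
    proof -
      from that obtain a b where "\<forall>j\<in>J. a j \<in> F" "u = (\<Sum>j\<in>J. a j * e j)"
        "\<forall>j\<in>J. b j \<in> F" "w = (\<Sum>j\<in>J. b j * e j)" by (auto simp: V_def)
      then show ?thesis unfolding V_def using F
        by (intro CollectI exI[of _ "\<lambda>j. a j + b j"])
          (auto intro: subfield_closed simp: sum.distrib algebra_simps)
    qed
    have V_scale: "c * u \<in> V" if "c \<in> F" "u \<in> V" for c u
    proof -
      from that obtain a where "\<forall>j\<in>J. a j \<in> F" "u = (\<Sum>j\<in>J. a j * e j)" by (auto simp: V_def)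
      then show ?thesis unfolding V_def using F \<open>c \<in> F\<close>
        by (intro CollectI exI[of _ "\<lambda>j. c * a j"])
          (auto intro: subfield_closed simp: sum_distrib_left algebra_simps)
    qed
    have V_0: "0 \<in> V" using V_scale[OF _ V_mono[of 0 0], of 0] F by (simp add: subfield_closed)
    have V_sum: "sum f I \<in> V" if "\<And>i. i \<in> I \<Longrightarrow> f i \<in> V" for f and I :: "nat set"
      using that by (induction I rule: infinite_finite_induct) (auto intro: V_0 V_add)
    have *: "z \<in> ?A" if "\<And>n. z ^ n \<in> V" for z
      using that by (intro algebraic_elementsI[OF F, of J _ e]) (auto simp: V_def J_def)
    have "(x + y) ^ n \<in> V" for n
      unfolding binomial_ring
      by (intro V_sum) (auto simp: mult.assoc intro!: V_scale V_mono subfield_of_nat[OF F])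
    moreover have "(x * y) ^ n \<in> V" for n
      unfolding power_mult_distrib by (rule V_mono)
    ultimately show ?thesis using * by blast
  qed
  have inv: "inverse x \<in> ?A" if x: "x \<in> ?A" for x
  proof (cases "x = 0")
    case False
    obtain p where p: "p \<in> polys_over F" "p \<noteq> 0" "poly p x = 0"
      using x by (auto simp: algebraic_elements_def)
    have "reflect_poly p \<in> polys_over F"
      using p F by (intro polys_overI) (auto simp: coeff_reflect_poly polys_over_def subfield_closed)
    moreover have "poly (reflect_poly p) (inverse x) = 0"
      using False p poly_reflect_poly_nz[of "inverse x" p] by simp
    ultimately show ?thesis using p
      by (auto simp: algebraic_elements_def intro!: bexI[of _ "reflect_poly p"])
  qed (use x in simp)
  have base: "x \<in> ?A" if "x \<in> F" for x using subfield_elem_algebraic[OF F that] .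
  have "- x \<in> ?A" if "x \<in> ?A" for x
  proof -
    have "(- 1) * x \<in> ?A"
      using sum_prod[OF base that] F by (blast intro: subfield_closed)
    then show ?thesis by simp
  qed
  with sum_prod inv base[OF subfield_zero[OF F]] base[OF subfield_one[OF F]] show ?thesis
    by (simp add: is_subfield_def)
qed

section \<open>The shift operator and exponential polynomials\<close>

text \<open>The polynomial \<open>p\<close> evaluated at the shift \<open>s \<mapsto> (\<lambda>n. s (n + 1))\<close>, acting on the sequence \<open>s\<close>. Thus
\<open>apply_shift p s = 0\<close> says that \<open>s\<close> satisfies the linear recurrence with characteristic polynomial
\<open>p\<close>.\<close>

definition apply_shift :: "'a::field_char_0 poly \<Rightarrow> (int \<Rightarrow> 'a) \<Rightarrow> int \<Rightarrow> 'a" where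
  "apply_shift p s n = (\<Sum>k\<le>degree p. coeff p k * s (n + int k))"

definition expol :: "'a::field_char_0 \<Rightarrow> 'a poly \<Rightarrow> int \<Rightarrow> 'a" where
  "expol a \<mu> n = poly \<mu> (of_int n) * a powi n"

lemma apply_shift_upto:
  "degree p \<le> N \<Longrightarrow> apply_shift p s n = (\<Sum>k\<le>N. coeff p k * s (n + int k))"
  unfolding apply_shift_def by (intro sum.mono_neutral_left) (auto simp: coeff_eq_0)

lemma apply_shift_0 [simp]: "apply_shift 0 s n = 0"
  by (simp add: apply_shift_def)

lemma apply_shift_1 [simp]: "apply_shift 1 s = s"
  by (auto simp: apply_shift_def)

lemma apply_shift_add: "apply_shift (p + q) s n = apply_shift p s n + apply_shift q s n"
  using degree_add_le_max[of p q]
  by (simp add: apply_shift_upto[of _ "max (degree p) (degree q)"] algebra_simps sum.distrib)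

lemma apply_shift_smult: "apply_shift (smult c p) s n = c * apply_shift p s n"
  using degree_smult_le[of c p]
  by (simp add: apply_shift_upto[of _ "degree p"] sum_distrib_left mult.assoc)

lemma apply_shift_pCons: "apply_shift (pCons a p) s n = a * s n + apply_shift p s (n + 1)"
proof -
  have "degree (pCons a p) \<le> Suc (degree p)" by (rule degree_pCons_le)
  then have "apply_shift (pCons a p) s n = (\<Sum>k\<le>Suc (degree p). coeff (pCons a p) k * s (n + int k))"
    by (rule apply_shift_upto)
  also have "\<dots> = a * s n + apply_shift p s (n + 1)"
    by (subst sum.atMost_Suc_shift) (simp add: apply_shift_def add_ac)
  finally show ?thesis .
qed

lemma apply_shift_mult: "apply_shift (p * q) s = apply_shift p (apply_shift q s)"
proof (induction p)
  case (pCons a p)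
  then have "apply_shift (p * q) s n = apply_shift p (apply_shift q s) n" for n by simp
  then show ?case
    by (intro ext) (simp add: apply_shift_add apply_shift_smult apply_shift_pCons)
qed (auto intro: ext)

lemma apply_shift_zero_seq: "(\<And>m. m \<ge> n \<Longrightarrow> s m = 0) \<Longrightarrow> apply_shift p s n = 0"
  by (simp add: apply_shift_def)

lemma apply_shift_sum_seq:
  "apply_shift p (\<lambda>m. \<Sum>i\<in>A. s i m) n = (\<Sum>i\<in>A. apply_shift p (s i) n)"
  unfolding apply_shift_def sum_distrib_left by (rule sum.swap)

lemma apply_shift_diff_seq:
  "apply_shift p (\<lambda>m. s m - t m) n = apply_shift p s n - apply_shift p t n"
  by (simp add: apply_shift_def algebra_simps sum_subtractf)

lemma apply_shift_scale_seq: "apply_shift p (\<lambda>m. c * s m) n = c * apply_shift p s n"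
  by (simp add: apply_shift_def algebra_simps sum_distrib_left)

lemma apply_shift_in_subfield:
  assumes "is_subfield F" "p \<in> polys_over F" "\<And>m. m \<ge> n \<Longrightarrow> s m \<in> F"
  shows "apply_shift p s n \<in> F"
  unfolding apply_shift_def using assms by (auto intro!: subfield_closed dest: polys_overD)

lemma hom_apply_shift:
  assumes "is_subfield L" "field_hom_on L h" "p \<in> polys_over L" "\<And>m. m \<ge> n \<Longrightarrow> s m \<in> L"
  shows "h (apply_shift p s n) = apply_shift (map_poly h p) (\<lambda>m. h (s m)) n"
proof -
  interpret subfield_hom L h by standard fact+
  show ?thesis unfolding apply_shift_def using assms
    by (simp add: hom_sum hom_mult degree_map_hom coeff_map_hom subfield_closed polys_overD)
qed

lemma expol_diff: "expol a (\<mu> - \<nu>) n = expol a \<mu> n - expol a \<nu> n"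
  and expol_0: "expol a 0 n = 0"
  and expol_smult: "expol a (smult c \<mu>) n = c * expol a \<mu> n"
  and expol_sum: "expol a (\<Sum>i\<in>A. f i) n = (\<Sum>i\<in>A. expol a (f i) n)"
  by (simp_all add: expol_def algebra_simps poly_sum sum_distrib_left)

lemma expol_in_subfield:
  assumes "is_subfield F" "a \<in> F" "\<mu> \<in> polys_over F"
  shows "expol a \<mu> n \<in> F"
  unfolding expol_def using assms by (auto intro!: subfield_closed poly_in_subfield)

lemma hom_expol:
  assumes "is_subfield L" "field_hom_on L h" "a \<in> L" "\<mu> \<in> polys_over L"
  shows "h (expol a \<mu> n) = expol (h a) (map_poly h \<mu>) n"
proof -
  interpret subfield_hom L h by standard fact+
  show ?thesis unfolding expol_def using assms poly_map_hom[of \<mu> "of_int n"]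
    by (simp add: hom_mult hom_powi hom_of_int subfield_closed poly_in_subfield)
qed

text \<open>In characteristic zero the integers \<open>n \<ge> n0\<close> would be infinitely many roots of \<open>\<mu>\<close>.\<close>

lemma expol_eventually_zero:
  assumes "a \<noteq> 0" "\<And>n. n \<ge> n0 \<Longrightarrow> expol a \<mu> n = 0"
  shows "\<mu> = 0"
proof (rule ccontr)
  assume "\<mu> \<noteq> 0"
  then have "finite {x. poly \<mu> x = 0}" by (rule poly_roots_finite)
  moreover have "of_int ` {n0..} \<subseteq> {x. poly \<mu> x = 0}" using assms by (auto simp: expol_def)
  ultimately have "finite ((of_int :: int \<Rightarrow> 'a) ` {n0..})" by (rule finite_subset[rotated])
  then show False by (subst (asm) finite_image_iff) (auto simp: inj_on_def infinite_Ici)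
qed

text \<open>The shift maps \<open>\<mu>(n) a ^ n\<close> to \<open>a \<mu>(n + 1) a ^ n\<close>, and \<open>\<mu>(X)\<close> and \<open>\<mu>(X + 1)\<close> have the same leading
term. So on leading coefficients \<open>q\<close> acts as multiplication by \<open>poly q a\<close>, which makes \<open>q\<close> injective
on these sequences when \<open>a\<close> is not a root of \<open>q\<close>.\<close>

lemma apply_shift_expol:
  assumes "a \<noteq> 0"
  shows "\<exists>\<nu>. apply_shift q (expol a \<mu>) = expol a \<nu> \<and> degree \<nu> \<le> degree \<mu> \<and>
           coeff \<nu> (degree \<mu>) = poly q a * lead_coeff \<mu>"
proof (induction q)
  case 0
  show ?case by (intro exI[of _ 0]) (auto simp: expol_0)
next
  case (pCons b q)
  then obtain \<nu> where \<nu>: "apply_shift q (expol a \<mu>) = expol a \<nu>" "degree \<nu> \<le> degree \<mu>"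
    "coeff \<nu> (degree \<mu>) = poly q a * lead_coeff \<mu>" by blast
  define \<nu>' where "\<nu>' = \<nu> \<circ>\<^sub>p [:1, 1:]"
  have deg: "degree \<nu>' = degree \<nu>" by (simp add: \<nu>'_def degree_pcompose)
  have lc: "coeff \<nu>' (degree \<mu>) = coeff \<nu> (degree \<mu>)"
  proof (cases "degree \<nu> = degree \<mu>")
    case True
    then show ?thesis using lead_coeff_comp[of "[:1, 1:]" \<nu>] deg by (simp add: \<nu>'_def)
  next
    case False
    with \<nu>(2) deg show ?thesis by (simp add: coeff_eq_0)
  qed
  have "apply_shift (pCons b q) (expol a \<mu>) n = expol a (smult b \<mu> + smult a \<nu>') n" for n
    using assms unfolding apply_shift_pCons \<nu>(1)
    by (simp add: expol_def \<nu>'_def poly_pcompose power_int_add algebra_simps)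
  moreover have "degree (smult b \<mu> + smult a \<nu>') \<le> degree \<mu>"
    using \<nu>(2) deg by (intro degree_add_le) (auto intro: order_trans[OF degree_smult_le])
  ultimately show ?case using lc \<nu>(3)
    by (intro exI[of _ "smult b \<mu> + smult a \<nu>'"]) (auto simp: algebra_simps)
qed

lemma apply_shift_expol_eq_zero_imp:
  assumes "a \<noteq> 0" "poly q a \<noteq> 0" "\<And>n. n \<ge> n0 \<Longrightarrow> apply_shift q (expol a \<mu>) n = 0"
  shows "\<mu> = 0"
proof -
  obtain \<nu> where \<nu>: "apply_shift q (expol a \<mu>) = expol a \<nu>" "coeff \<nu> (degree \<mu>) = poly q a * lead_coeff \<mu>"
    using apply_shift_expol[OF assms(1)] by blast
  have "\<nu> = 0" using assms(3) \<nu>(1) by (intro expol_eventually_zero[OF assms(1), of n0]) simp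
  with \<nu>(2) assms(2) show ?thesis by simp
qed

lemma apply_shift_expol_eq_imp:
  assumes "a \<noteq> 0" "poly q a \<noteq> 0"
    "\<And>n. n \<ge> n0 \<Longrightarrow> apply_shift q (expol a \<mu>) n = apply_shift q (expol a \<nu>) n"
  shows "\<mu> = \<nu>"
proof -
  have "apply_shift q (expol a (\<mu> - \<nu>)) n = 0" if "n \<ge> n0" for n
    using assms(3)[OF that] by (simp add: expol_diff[abs_def] apply_shift_diff_seq)
  from apply_shift_expol_eq_zero_imp[OF assms(1,2) this] show ?thesis by simp
qed

subsection \<open>Powers of the difference operator\<close>

text \<open>The two leading terms of \<open>\<mu>(X + 1)\<close>, which show that the difference \<open>\<mu>(X + 1) - \<mu>(X)\<close> loses exactly
one degree in characteristic zero.\<close>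

lemma coeff_pcompose_shift:
  fixes \<mu> :: "'a::comm_ring_1 poly"
  assumes "degree \<mu> \<le> Suc n"
  shows "coeff (\<mu> \<circ>\<^sub>p [:1, 1:]) (Suc n) = coeff \<mu> (Suc n) \<and>
    coeff (\<mu> \<circ>\<^sub>p [:1, 1:]) n = coeff \<mu> n + of_nat (Suc n) * coeff \<mu> (Suc n)"
  using assms
proof (induction \<mu> arbitrary: n)
  case (pCons b \<mu>)
  have eq: "pCons b \<mu> \<circ>\<^sub>p [:1, 1:] = [:b:] + \<mu> \<circ>\<^sub>p [:1, 1:] + pCons 0 (\<mu> \<circ>\<^sub>p [:1, 1:])"
    by (simp add: pcompose_pCons)
  have deg: "degree \<mu> \<le> n" using pCons by (cases "\<mu> = 0") auto
  have deg': "degree (\<mu> \<circ>\<^sub>p [:1, 1:]) \<le> n"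
    using degree_pcompose_le[of \<mu> "[:1, 1:]"] deg by simp
  show ?case
  proof (cases n)
    case 0
    with deg obtain c where "\<mu> = [:c:]" by (auto elim: degree_eq_zeroE)
    with 0 show ?thesis by (simp add: pcompose_pCons)
  next
    case (Suc k)
    from pCons.IH[of k] deg deg' Suc show ?thesis
      unfolding eq by (simp add: coeff_eq_0 algebra_simps)
  qed
qed auto

lemma apply_shift_difference:
  assumes "a \<noteq> 0"
  shows "apply_shift [:- a, 1:] (expol a \<mu>) = expol a (smult a (\<mu> \<circ>\<^sub>p [:1, 1:] - \<mu>))"
  using assms
  by (intro ext) (simp add: apply_shift_pCons expol_def poly_pcompose power_int_add algebra_simps)

lemma degree_difference:
  fixes \<mu> :: "'a::field_char_0 poly"
  assumes "degree \<mu> = Suc n"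
  shows "degree (\<mu> \<circ>\<^sub>p [:1, 1:] - \<mu>) = n"
proof (rule antisym)
  have "coeff (\<mu> \<circ>\<^sub>p [:1, 1:] - \<mu>) i = 0" if "i > n" for i
  proof (cases "i = Suc n")
    case True
    with coeff_pcompose_shift[of \<mu> n] assms show ?thesis by simp
  next
    case False
    with that assms have "i > degree \<mu>" "i > degree (\<mu> \<circ>\<^sub>p [:1, 1:])"
      by (auto simp: degree_pcompose)
    then show ?thesis by (simp add: coeff_eq_0)
  qed
  then show "degree (\<mu> \<circ>\<^sub>p [:1, 1:] - \<mu>) \<le> n" by (intro degree_le) auto
  have "coeff (\<mu> \<circ>\<^sub>p [:1, 1:] - \<mu>) n = of_nat (Suc n) * lead_coeff \<mu>"
    using coeff_pcompose_shift[of \<mu> n] assms by simp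
  moreover have "lead_coeff \<mu> \<noteq> 0"
    using assms by (metis degree_0 leading_coeff_0_iff nat.distinct(1))
  ultimately show "n \<le> degree (\<mu> \<circ>\<^sub>p [:1, 1:] - \<mu>)"
    by (intro le_degree) (simp del: of_nat_Suc)
qed

lemma apply_shift_difference_power:
  assumes "a \<noteq> 0" "\<mu> \<noteq> 0" "r \<le> degree \<mu>"
  shows "\<exists>\<nu>. \<nu> \<noteq> 0 \<and> degree \<nu> = degree \<mu> - r \<and> apply_shift ([:- a, 1:] ^ r) (expol a \<mu>) = expol a \<nu>"
  using assms(3)
proof (induction r)
  case 0
  with assms show ?case by (intro exI[of _ \<mu>]) simp
next
  case (Suc r)
  then obtain \<nu> where \<nu>: "degree \<nu> = degree \<mu> - r" "apply_shift ([:- a, 1:] ^ r) (expol a \<mu>) = expol a \<nu>"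
    by auto
  have Suc_deg: "degree \<nu> = Suc (degree \<mu> - Suc r)" using \<nu>(1) Suc.prems by simp
  have deg: "degree (\<nu> \<circ>\<^sub>p [:1, 1:] - \<nu>) = degree \<mu> - Suc r"
    by (rule degree_difference[OF Suc_deg])
  have "\<nu> \<circ>\<^sub>p [:1, 1:] - \<nu> \<noteq> 0"
  proof
    assume "\<nu> \<circ>\<^sub>p [:1, 1:] - \<nu> = 0"
    with coeff_pcompose_shift[of \<nu> "degree \<mu> - Suc r"] Suc_deg
    have "of_nat (Suc (degree \<mu> - Suc r)) * lead_coeff \<nu> = 0" by (simp del: of_nat_Suc)
    then have "\<nu> = 0" by (simp del: of_nat_Suc)
    with Suc_deg show False by simp
  qed
  moreover have "apply_shift ([:- a, 1:] ^ Suc r) (expol a \<mu>) = expol a (smult a (\<nu> \<circ>\<^sub>p [:1, 1:] - \<nu>))"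
    by (simp only: power_Suc apply_shift_mult \<nu>(2) apply_shift_difference[OF assms(1)])
  ultimately show ?case using assms(1) deg
    by (intro exI[of _ "smult a (\<nu> \<circ>\<^sub>p [:1, 1:] - \<nu>)"]) simp
qed

lemma apply_shift_difference_power_degree:
  assumes "a \<noteq> 0" "\<mu> \<noteq> 0"
  shows "\<exists>c. c \<noteq> 0 \<and> apply_shift ([:- a, 1:] ^ degree \<mu>) (expol a \<mu>) = expol a [:c:]"
proof -
  obtain \<nu> where "\<nu> \<noteq> 0" "degree \<nu> = 0" "apply_shift ([:- a, 1:] ^ degree \<mu>) (expol a \<mu>) = expol a \<nu>"
    using apply_shift_difference_power[OF assms order_refl] by auto
  then show ?thesis by (metis degree_eq_zeroE pCons_eq_0_iff)
qed

lemma apply_shift_annihilates: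
  assumes "a \<noteq> 0"
  shows "apply_shift ([:- a, 1:] ^ Suc (degree \<mu>)) (expol a \<mu>) n = 0"
proof (cases "\<mu> = 0")
  case True
  then show ?thesis by (auto intro!: apply_shift_zero_seq simp: expol_0)
next
  case False
  then obtain c where c: "apply_shift ([:- a, 1:] ^ degree \<mu>) (expol a \<mu>) = expol a [:c:]"
    using apply_shift_difference_power_degree[OF assms] by blast
  show ?thesis
    by (simp add: power_Suc apply_shift_mult c apply_shift_difference[OF assms] pcompose_pCons expol_0
        del: mult_pCons_left)
qed

text \<open>Write \<open>p = (X - a) ^ r * q\<close> with \<open>q(a) \<noteq> 0\<close>. If \<open>r \<le> degree \<mu>\<close>, then the power of \<open>X - a\<close> leaves a
nonzero exponential polynomial, on which \<open>q\<close> is injective.\<close>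

lemma annihilator_order:
  assumes "a \<noteq> 0" "\<mu> \<noteq> 0" and ann: "\<And>n. n \<ge> n0 \<Longrightarrow> apply_shift p (expol a \<mu>) n = 0"
  shows "[:- a, 1:] ^ Suc (degree \<mu>) dvd p"
proof (cases "p = 0")
  case False
  obtain q where q: "p = [:- a, 1:] ^ order a p * q" "\<not> [:- a, 1:] dvd q"
    using order_decomp[OF False] by blast
  have "order a p > degree \<mu>"
  proof (rule ccontr)
    assume "\<not> ?thesis"
    then obtain \<nu> where \<nu>: "\<nu> \<noteq> 0" "apply_shift ([:- a, 1:] ^ order a p) (expol a \<mu>) = expol a \<nu>"
      using apply_shift_difference_power[OF assms(1,2), of "order a p"] by auto
    have "apply_shift q (expol a \<nu>) n = 0" if "n \<ge> n0" for n
      using ann[OF that] q(1) \<nu>(2)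
      by (metis apply_shift_mult mult.commute)
    moreover have "poly q a \<noteq> 0" using q(2) by (simp add: poly_eq_0_iff_dvd)
    ultimately show False using apply_shift_expol_eq_zero_imp[OF assms(1)] \<nu>(1) by blast
  qed
  then show ?thesis by (simp add: order_divides del: power_Suc)
qed simp

text \<open>The factors are pairwise coprime. In terms of orders: the product over \<open>A\<close> does not vanish at the new
point \<open>\<alpha> i\<close>, so the order of \<open>p\<close> at that point is the order of the quotient.\<close>

lemma prod_linear_powers_dvd:
  fixes p :: "'a::field poly"
  assumes "finite A" "inj_on \<alpha> A" "\<And>i. i \<in> A \<Longrightarrow> [:- \<alpha> i, 1:] ^ d i dvd p"
  shows "(\<Prod>i\<in>A. [:- \<alpha> i, 1:] ^ d i) dvd p"
  using assms
proof (induction A)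
  case (insert i A)
  then obtain q where q: "p = (\<Prod>i\<in>A. [:- \<alpha> i, 1:] ^ d i) * q" by (auto elim: dvdE)
  have nz: "poly (\<Prod>i\<in>A. [:- \<alpha> i, 1:] ^ d i) (\<alpha> i) \<noteq> 0"
    using insert by (auto simp: poly_prod inj_on_def)
  have "[:- \<alpha> i, 1:] ^ d i dvd q"
  proof (cases "p = 0")
    case False
    then have "order (\<alpha> i) p = order (\<alpha> i) q"
      using nz order_mult[of "\<Prod>i\<in>A. [:- \<alpha> i, 1:] ^ d i" q "\<alpha> i"] q by (auto simp: order_0I)
    with insert.prems(2)[of i] False q show ?thesis by (auto simp: order_divides)
  next
    case True
    with q nz have "q = 0" by auto
    then show ?thesis by simp
  qed
  with insert.hyps show ?case unfolding q by (simp add: mult.commute mult_dvd_mono)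
qed simp

section \<open>Conjugates over a subfield\<close>

text \<open>A nonzero element of least degree generates the ideal of polynomials over \<open>M\<close> that vanish at
\<open>a\<close>, by division with remainder.\<close>

lemma minimal_polynomial:
  assumes M: "is_subfield M" and "a \<in> algebraic_elements M"
  obtains h where "h \<in> polys_over M" "h \<noteq> 0" "poly h a = 0"
    "\<And>q. q \<in> polys_over M \<Longrightarrow> poly q a = 0 \<Longrightarrow> h dvd q"
proof -
  let ?P = "\<lambda>p. p \<in> polys_over M \<and> p \<noteq> 0 \<and> poly p a = 0"
  obtain p where "?P p" using assms by (auto simp: algebraic_elements_def)
  from ex_has_least_nat[of ?P p degree, OF this] obtain h where
    h: "?P h" and least: "\<And>q. ?P q \<Longrightarrow> degree h \<le> degree q" by blast
  have "h dvd q" if q: "q \<in> polys_over M" "poly q a = 0" for q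
  proof -
    obtain s t where st: "t \<in> polys_over M" "q = h * s + t" "t = 0 \<or> degree t < degree h"
      using polys_over_division[OF M q(1)] h by blast
    have "poly t a = 0" using q(2) st(2) h by simp
    with least[of t] st have "t = 0" by (metis not_le)
    with st show ?thesis by simp
  qed
  with h that show ?thesis by blast
qed

text \<open>The Euclidean algorithm for \<open>q\<close> and the minimal polynomial \<open>h\<close>: writing
\<open>h = q * s + t\<close> gives \<open>t(a) = - q(a) s(a)\<close>, so it suffices to invert \<open>t(a)\<close>, where \<open>t\<close> has
smaller degree than \<open>q\<close>. This is what makes \<open>M[a]\<close> a field.\<close>

lemma inverse_polynomial:
  assumes M: "is_subfield M" and "a \<in> algebraic_elements M"
    and "q \<in> polys_over M" "poly q a \<noteq> 0"
  shows "\<exists>r\<in>polys_over M. poly q a * poly r a = 1"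
proof -
  obtain h where h: "h \<in> polys_over M" "h \<noteq> 0" "poly h a = 0"
    "\<And>q. q \<in> polys_over M \<Longrightarrow> poly q a = 0 \<Longrightarrow> h dvd q"
    using minimal_polynomial[OF assms(1,2)] by blast
  have *: "\<exists>r\<in>polys_over M. poly q a * poly r a = 1"
    if "q \<in> polys_over M" "poly q a \<noteq> 0" "degree q < degree h" for q
    using that
  proof (induction "degree q" arbitrary: q rule: less_induct)
    case less
    obtain s t where st: "s \<in> polys_over M" "t \<in> polys_over M" "h = q * s + t"
      "t = 0 \<or> degree t < degree q"
      using polys_over_division[OF M h(1) less.prems(1)] less.prems(2) by force
    show ?case
    proof (cases "degree q = 0")
      case True
      then obtain c where c: "q = [:c:]" by (auto elim: degree_eq_zeroE)
      with less.prems have "c \<in> M" "c \<noteq> 0" by (auto dest: polys_overD[of _ _ 0])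
      then show ?thesis using M c
        by (intro bexI[of _ "[:inverse c:]"])
          (auto intro!: polys_over_pCons polys_over_0 subfield_closed)
    next
      case False
      have eq: "poly t a = - (poly q a * poly s a)"
        using h(3) st(3) by (simp add: eq_neg_iff_add_eq_0 add.commute)
      \<comment> \<open>Otherwise \<open>h\<close> divides \<open>t\<close>, so \<open>t = 0\<close> and \<open>h = q * s\<close> with \<open>s(a) = 0\<close>, against the minimality of the degree of \<open>h\<close>.\<close>
      have "poly t a \<noteq> 0"
      proof
        assume "poly t a = 0"
        then have "poly s a = 0" "h dvd t" using eq less.prems h(4) st by auto
        then have "h dvd s" using h(4) st by blast
        have "t = 0"
          using \<open>h dvd t\<close> dvd_imp_degree_le[of h t] st(4) less.prems(3) by fastforce
        have "s \<noteq> 0" using \<open>t = 0\<close> st(3) h(2) by auto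
        then have "degree h = degree q + degree s" using st(3) \<open>t = 0\<close> h(2)
          by (auto simp: degree_mult_eq)
        moreover have "degree h \<le> degree s" using \<open>h dvd s\<close> \<open>s \<noteq> 0\<close> by (rule dvd_imp_degree_le)
        ultimately show False using False by simp
      qed
      then obtain r where r: "r \<in> polys_over M" "poly t a * poly r a = 1"
        using less.hyps[of t] st less.prems by (cases "t = 0") auto
      have "poly q a * poly (- (s * r)) a = 1" using r(2) by (simp add: eq algebra_simps)
      with r st M show ?thesis
        by (intro bexI[of _ "- (s * r)"]) (auto intro!: polys_over_uminus polys_over_mult)
    qed
  qed
  obtain s t where st: "t \<in> polys_over M" "q = h * s + t" "t = 0 \<or> degree t < degree h"
    using polys_over_division[OF M assms(3) h(1,2)] by blast
  have eq: "poly q a = poly t a" using st(2) h(3) by simp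
  with st(3) assms(4) have "degree t < degree h" by auto
  from *[OF st(1) _ this] assms(4) show ?thesis unfolding eq by simp
qed

lemma adjoin_algebraic_element:
  assumes M: "is_subfield M" and a: "a \<in> algebraic_elements M"
  shows "adjoin M {a} = (\<lambda>q. poly q a) ` polys_over M" (is "_ = ?R")
proof
  have mem: "x \<in> ?R" if "q \<in> polys_over M" "poly q a = x" for x q
    using that by auto
  have "is_subfield ?R"
    unfolding is_subfield_def
  proof (intro conjI ballI)
    show "0 \<in> ?R" "1 \<in> ?R"
      using M by (auto intro: mem[of 0] mem[of 1] polys_over_0 polys_over_1)
  next
    fix x y assume "x \<in> ?R" "y \<in> ?R"
    then obtain p q where pq: "p \<in> polys_over M" "q \<in> polys_over M" "x = poly p a" "y = poly q a"
      by auto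
    with M show "x + y \<in> ?R" "x * y \<in> ?R"
      by (auto intro: mem[of "p + q"] mem[of "p * q"] polys_over_add polys_over_mult)
  next
    fix x assume "x \<in> ?R"
    then obtain p where p: "p \<in> polys_over M" "x = poly p a" by auto
    with M show "- x \<in> ?R" by (auto intro: mem[of "- p"] polys_over_uminus)
    show "inverse x \<in> ?R"
    proof (cases "x = 0")
      case True
      with p show ?thesis by simp
    next
      case False
      with inverse_polynomial[OF M a p(1)] p obtain r where "r \<in> polys_over M" "x * poly r a = 1"
        by auto
      then show ?thesis by (auto intro: mem[of r] simp: inverse_unique)
    qed
  qed
  moreover have "M \<subseteq> ?R" using M by (auto intro!: mem[of "[:_:]"] polys_over_pCons polys_over_0)
  moreover have "a \<in> ?R"
    using M by (intro mem[of "[:0, 1:]"]) (auto intro!: polys_over_pCons polys_over_0 subfield_closed)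
  ultimately show "adjoin M {a} \<subseteq> ?R" by (intro adjoin_least) auto
  show "?R \<subseteq> adjoin M {a}"
  proof clarify
    fix q assume "q \<in> polys_over M"
    then have "q \<in> polys_over (adjoin M {a})" using polys_over_mono[OF adjoin_base] by blast
    then show "poly q a \<in> adjoin M {a}"
      using is_subfield_adjoin adjoin_gens[of "{a}" M] by (intro poly_in_subfield) auto
  qed
qed

text \<open>The map \<open>q(a) \<mapsto> q(b)\<close> is well defined because \<open>q(b)\<close> vanishes whenever \<open>q(a)\<close> does.\<close>

lemma embedding_of_conjugate:
  assumes M: "is_subfield M" and a: "a \<in> algebraic_elements M"
    and conj: "\<And>q. q \<in> polys_over M \<Longrightarrow> poly q a = 0 \<Longrightarrow> poly q b = 0"
  shows "\<exists>\<tau>. field_hom_on (adjoin M {a}) \<tau> \<and> (\<forall>x\<in>M. \<tau> x = x) \<and> \<tau> a = b"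
proof -
  define \<tau> where "\<tau> x = poly (SOME q. q \<in> polys_over M \<and> poly q a = x) b" for x
  have \<tau>: "\<tau> x = poly q b" if q: "q \<in> polys_over M" "poly q a = x" for q x
  proof -
    have "\<exists>q. q \<in> polys_over M \<and> poly q a = x" using that by blast
    from someI_ex[OF this] obtain p where p: "p \<in> polys_over M" "poly p a = x" "\<tau> x = poly p b"
      unfolding \<tau>_def by blast
    from conj[of "p - q"] p q M show ?thesis by (auto intro: polys_over_diff)
  qed
  have "field_hom_on (adjoin M {a}) \<tau>"
    unfolding field_hom_on_def adjoin_algebraic_element[OF M a]
  proof (intro conjI ballI)
    show "\<tau> 1 = 1" using \<tau>[of 1 1] M by (simp add: polys_over_1)
    fix x y assume "x \<in> (\<lambda>q. poly q a) ` polys_over M" "y \<in> (\<lambda>q. poly q a) ` polys_over M"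
    then obtain p q where pq: "p \<in> polys_over M" "poly p a = x" "q \<in> polys_over M" "poly q a = y"
      by blast
    show "\<tau> (x + y) = \<tau> x + \<tau> y"
      using \<tau>[OF pq(1,2)] \<tau>[OF pq(3,4)] \<tau>[of "p + q" "x + y"] pq M by (auto simp: polys_over_add)
    show "\<tau> (x * y) = \<tau> x * \<tau> y"
      using \<tau>[OF pq(1,2)] \<tau>[OF pq(3,4)] \<tau>[of "p * q" "x * y"] pq M by (auto simp: polys_over_mult)
  qed
  moreover have "\<tau> x = x" if "x \<in> M" for x
    using \<tau>[of "[:x:]" x] that M by (auto simp: polys_over_pCons polys_over_0)
  moreover have "\<tau> a = b"
    using \<tau>[of "[:0, 1:]" a] M by (auto simp: polys_over_pCons polys_over_0 subfield_closed)
  ultimately show ?thesis by blast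
qed

lemma coeff_linear_power_pred:
  "coeff ([:- a, 1:] ^ Suc n) n = - (of_nat (Suc n) * (a :: 'a::comm_ring_1))"
proof (induction n)
  case (Suc n)
  have "coeff ([:- a, 1:] ^ Suc (Suc n)) (Suc n) =
      - a * coeff ([:- a, 1:] ^ Suc n) (Suc n) + coeff ([:- a, 1:] ^ Suc n) n"
    by (subst power_Suc) (simp del: power_Suc)
  then show ?case unfolding Suc.IH coeff_linear_power by (simp add: algebra_simps)
qed simp

text \<open>In characteristic zero \<open>a\<close> can be read off the second coefficient \<open>- n a\<close> of \<open>(X - a) ^ n\<close>; this is
the separability used below.\<close>

lemma linear_power_over_subfield:
  fixes a :: "'a::field_char_0"
  assumes M: "is_subfield M" and "[:- a, 1:] ^ n \<in> polys_over M" "n > 0"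
  shows "a \<in> M"
proof -
  obtain l where l: "n = Suc l" using assms(3) gr0_implies_Suc by blast
  have "- (of_nat (Suc l) * a) \<in> M"
    using polys_overD[OF assms(2), of l] unfolding l coeff_linear_power_pred .
  from subfield_divide[OF M subfield_uminus[OF M this] subfield_of_nat[OF M, of "Suc l"]]
  show ?thesis by (simp del: of_nat_Suc)
qed

text \<open>A linear factor \<open>X - b\<close> can be cancelled from a multiple of \<open>r\<close> if \<open>r(b) \<noteq> 0\<close>, because it must divide
the complementary factor.\<close>

lemma rootless_dvd_prod_linear_powers:
  fixes r :: "'a::field poly"
  assumes "finite A" "\<And>x. poly r x \<noteq> 0" "r dvd (\<Prod>i\<in>A. [:- \<alpha> i, 1:] ^ d i)"
  shows "degree r = 0"
proof -
  have step: "r dvd w" if "r dvd [:- b, 1:] * w" for b w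
  proof -
    from that obtain s where s: "[:- b, 1:] * w = r * s" by (elim dvdE)
    have "poly (r * s) b = 0" unfolding s[symmetric] by simp
    then have "poly s b = 0" using assms(2)[of b] by simp
    then obtain s' where "s = [:- b, 1:] * s'" by (auto simp: poly_eq_0_iff_dvd elim: dvdE)
    with s have "[:- b, 1:] * w = [:- b, 1:] * (r * s')" by (simp only: mult.left_commute)
    then have "w = r * s'" by (subst (asm) mult_left_cancel) auto
    then show ?thesis by simp
  qed
  have steps: "r dvd w" if "r dvd [:- b, 1:] ^ n * w" for b n w
    using that by (induction n) (auto simp: mult.assoc dest: step simp del: mult_pCons_left)
  from assms(1,3) have "r dvd 1"
    by (induction A) (auto dest: steps)
  moreover have "r \<noteq> 0" using assms(2)[of 0] by auto
  ultimately show ?thesis by (simp add: is_unit_iff_degree)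
qed

text \<open>The minimal polynomial \<open>h\<close> of \<open>a\<close> divides a product of linear factors and is not a constant times a
power of \<open>X - a\<close>, because \<open>a \<notin> M\<close>. So \<open>h\<close> has a root \<open>b \<noteq> a\<close>, and \<open>a \<mapsto> b\<close> gives the embedding.\<close>

lemma nontrivial_embedding:
  fixes a :: "'a::field_char_0"
  assumes M: "is_subfield M" and "a \<notin> M" and "finite A"
    and f: "(\<Prod>i\<in>A. [:- \<alpha> i, 1:] ^ d i) \<in> polys_over M" "poly (\<Prod>i\<in>A. [:- \<alpha> i, 1:] ^ d i) a = 0"
  shows "\<exists>\<tau>. field_hom_on (adjoin M {a}) \<tau> \<and> (\<forall>x\<in>M. \<tau> x = x) \<and> \<tau> a \<noteq> a"
proof -
  let ?f = "\<Prod>i\<in>A. [:- \<alpha> i, 1:] ^ d i"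
  have "?f \<noteq> 0" using \<open>finite A\<close> by simp
  with f have alg: "a \<in> algebraic_elements M" unfolding algebraic_elements_def by blast
  obtain h where h: "h \<in> polys_over M" "h \<noteq> 0" "poly h a = 0"
    "\<And>q. q \<in> polys_over M \<Longrightarrow> poly q a = 0 \<Longrightarrow> h dvd q"
    using minimal_polynomial[OF M alg] by blast
  obtain r where r: "h = [:- a, 1:] ^ order a h * r" "\<not> [:- a, 1:] dvd r"
    using order_decomp[OF h(2)] by blast
  have "\<exists>b. poly r b = 0"
  proof (rule ccontr)
    assume no_root: "\<not> ?thesis"
    have "r dvd ?f" using h(4)[OF f] r(1) by (metis dvd_mult_right)
    then have "degree r = 0" using no_root \<open>finite A\<close> by (intro rootless_dvd_prod_linear_powers) auto
    then obtain c where c: "r = [:c:]" by (auto elim: degree_eq_zeroE)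
    have "c \<noteq> 0" using c r(1) h(2) by auto
    have eq: "h = smult c ([:- a, 1:] ^ order a h)" using r(1) c by simp
    have "lead_coeff (smult c ([:- a, 1:] ^ order a h)) = c"
      by (simp only: lead_coeff_smult lead_coeff_power) simp
    then have "lead_coeff h = c" by (subst (1 2) eq)
    with h(1) have "c \<in> M" by (auto dest: polys_overD)
    then have "smult (inverse c) h \<in> polys_over M"
      using M h by (intro polys_over_smult subfield_closed)
    moreover have "smult (inverse c) h = [:- a, 1:] ^ order a h"
      using arg_cong[OF eq, of "smult (inverse c)"] \<open>c \<noteq> 0\<close> by simp
    moreover have "order a h > 0" using h by (simp add: order_root)
    ultimately show False using linear_power_over_subfield[OF M] \<open>a \<notin> M\<close> by metis
  qed
  then obtain b where b: "poly r b = 0" ..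
  have "b \<noteq> a" using b r(2) by (auto simp: poly_eq_0_iff_dvd)
  have "poly h b = 0" using r(1) b by (metis mult_zero_right poly_mult)
  then have "poly q b = 0" if "q \<in> polys_over M" "poly q a = 0" for q
    using h(4)[OF that] by (auto elim!: dvdE)
  from embedding_of_conjugate[OF M alg this] \<open>b \<noteq> a\<close> show ?thesis by blast
qed

section \<open>Exponential sums with values in a subfield\<close>

locale exponential_sum =
  fixes A :: "'i set" and \<alpha> :: "'i \<Rightarrow> 'a::field_char_0" and lam :: "'i \<Rightarrow> 'a poly"
  assumes finite_A: "finite A" and inj: "inj_on \<alpha> A"
    and base_nz: "i \<in> A \<Longrightarrow> \<alpha> i \<noteq> 0" and lam_nz: "i \<in> A \<Longrightarrow> lam i \<noteq> 0"
begin

definition seq :: "int \<Rightarrow> 'a" where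
  "seq n = (\<Sum>i\<in>A. expol (\<alpha> i) (lam i) n)"

text \<open>The generator of the ideal of polynomials that annihilate \<open>seq\<close>, and hence the characteristic
polynomial of its shortest linear recurrence.\<close>

definition ann :: "'a poly" where
  "ann = (\<Prod>i\<in>A. [:- \<alpha> i, 1:] ^ Suc (degree (lam i)))"

definition cofactor :: "'i \<Rightarrow> 'a poly" where
  "cofactor i = (\<Prod>j\<in>A - {i}. [:- \<alpha> j, 1:] ^ Suc (degree (lam j)))"

lemma ann_nz: "ann \<noteq> 0"
  using finite_A by (simp add: ann_def del: power_Suc)

lemma ann_root_iff: "poly ann x = 0 \<longleftrightarrow> x \<in> \<alpha> ` A"
  using finite_A by (auto simp: ann_def poly_prod simp del: power_Suc)

lemma ann_monic: "lead_coeff ann = 1"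
  by (simp add: ann_def lead_coeff_prod lead_coeff_power del: power_Suc)

lemma ann_eq_cofactor: "i \<in> A \<Longrightarrow> ann = [:- \<alpha> i, 1:] ^ Suc (degree (lam i)) * cofactor i"
  unfolding ann_def cofactor_def by (rule prod.remove[OF finite_A])

lemma cofactor_nz: "i \<in> A \<Longrightarrow> poly (cofactor i) (\<alpha> i) \<noteq> 0"
  using finite_A inj by (auto simp: cofactor_def poly_prod inj_on_def simp del: power_Suc)

lemma apply_shift_seq_eq_term:
  assumes "i \<in> A" "\<And>j. j \<in> A - {i} \<Longrightarrow> [:- \<alpha> j, 1:] ^ Suc (degree (lam j)) dvd p"
  shows "apply_shift p seq = apply_shift p (expol (\<alpha> i) (lam i))"
proof
  fix n
  have zero: "apply_shift p (expol (\<alpha> j) (lam j)) n = 0" if "j \<in> A - {i}" for j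
  proof -
    from assms(2)[OF that] obtain q where "p = q * [:- \<alpha> j, 1:] ^ Suc (degree (lam j))"
      by (metis dvdE mult.commute)
    then show ?thesis using that base_nz
      by (simp add: apply_shift_mult apply_shift_annihilates apply_shift_zero_seq del: power_Suc)
  qed
  have "apply_shift p seq n = (\<Sum>j\<in>A. apply_shift p (expol (\<alpha> j) (lam j)) n)"
    by (simp add: seq_def[abs_def] apply_shift_sum_seq)
  also have "\<dots> = apply_shift p (expol (\<alpha> i) (lam i)) n"
    using finite_A assms(1) zero by (simp add: sum.remove)
  finally show "apply_shift p seq n = apply_shift p (expol (\<alpha> i) (lam i)) n" .
qed

lemma apply_shift_cofactor:
  "i \<in> A \<Longrightarrow> apply_shift (cofactor i) seq = apply_shift (cofactor i) (expol (\<alpha> i) (lam i))"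
  using finite_A by (intro apply_shift_seq_eq_term) (auto simp: cofactor_def simp del: power_Suc)

lemma apply_shift_ann: "apply_shift ann seq n = 0"
proof (cases "A = {}")
  case True
  have "seq m = 0" for m unfolding seq_def by (simp add: True)
  then show ?thesis by (intro apply_shift_zero_seq)
next
  case False
  then obtain i where i: "i \<in> A" by blast
  let ?L = "[:- \<alpha> i, 1:] ^ Suc (degree (lam i))"
  have "apply_shift ann seq = apply_shift ?L (apply_shift (cofactor i) (expol (\<alpha> i) (lam i)))"
    by (simp only: ann_eq_cofactor[OF i] apply_shift_mult apply_shift_cofactor[OF i])
  also have "\<dots> = apply_shift (cofactor i) (apply_shift ?L (expol (\<alpha> i) (lam i)))"
    by (simp only: apply_shift_mult[symmetric] mult.commute)
  finally show ?thesis
    by (simp add: base_nz i apply_shift_annihilates apply_shift_zero_seq del: power_Suc)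
qed

text \<open>The cofactor of \<open>i\<close> isolates the \<open>i\<close>-th term, so an annihilator of the sum, even of one of its tails,
annihilates every single term.\<close>

lemma ann_dvd_annihilator:
  assumes "\<And>n. n \<ge> n0 \<Longrightarrow> apply_shift p seq n = 0"
  shows "ann dvd p"
  unfolding ann_def
proof (rule prod_linear_powers_dvd[OF finite_A inj])
  fix i assume i: "i \<in> A"
  obtain \<nu> where \<nu>: "apply_shift p (expol (\<alpha> i) (lam i)) = expol (\<alpha> i) \<nu>"
    using apply_shift_expol[OF base_nz[OF i]] by blast
  have "apply_shift (cofactor i) (expol (\<alpha> i) \<nu>) n = 0" if "n \<ge> n0" for n
  proof -
    have "apply_shift (cofactor i) (expol (\<alpha> i) \<nu>) = apply_shift (cofactor i) (apply_shift p seq)"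
      unfolding \<nu>[symmetric] apply_shift_mult[symmetric] mult.commute[of "cofactor i"]
      unfolding apply_shift_mult apply_shift_cofactor[OF i] ..
    moreover have "apply_shift (cofactor i) (apply_shift p seq) n = 0"
      by (rule apply_shift_zero_seq) (use that assms in auto)
    ultimately show ?thesis by simp
  qed
  then have "\<nu> = 0"
    by (rule apply_shift_expol_eq_zero_imp[OF base_nz[OF i] cofactor_nz[OF i]])
  then show "[:- \<alpha> i, 1:] ^ Suc (degree (lam i)) dvd p"
    using annihilator_order[OF base_nz[OF i] lam_nz[OF i], of n0 p] \<nu> by (simp add: expol_0)
qed

text \<open>The isolated term \<open>cofactor i\<close> applied to \<open>seq\<close> has values in \<open>L\<close> and depends linearly and
injectively on \<open>lam i\<close>. So the coefficients of \<open>lam i\<close> are the unique solution of a linear system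
over \<open>L\<close>.\<close>

lemma lam_over_subfield:
  assumes L: "is_subfield L" and ann: "ann \<in> polys_over L"
    and seq: "\<And>n. n \<ge> n0 \<Longrightarrow> seq n \<in> L" and i: "i \<in> A" "\<alpha> i \<in> L"
  shows "cofactor i \<in> polys_over L" "lam i \<in> polys_over L"
proof -
  show cof: "cofactor i \<in> polys_over L"
  proof (rule polys_over_cancel_factor[OF L polys_over_linear_power[OF L i(2)]])
    show "[:- \<alpha> i, 1:] ^ Suc (degree (lam i)) * cofactor i \<in> polys_over L"
      using ann by (simp only: ann_eq_cofactor[OF i(1)])
  qed (simp del: power_Suc)
  let ?T = "\<lambda>\<mu>. apply_shift (cofactor i) (expol (\<alpha> i) \<mu>)"
  have lin: "?T (\<Sum>k\<le>N. smult (c k) (monom 1 k)) n = (\<Sum>k\<le>N. ?T (monom 1 k) n * c k)" for c N n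
    by (simp add: expol_sum[abs_def] expol_smult apply_shift_sum_seq apply_shift_scale_seq
        mult.commute)
  have "\<exists>c. (\<forall>k\<in>{..degree (lam i)}. c k \<in> L) \<and>
      (\<forall>n\<in>{n0..}. (\<Sum>k\<le>degree (lam i). ?T (monom 1 k) n * c k) = ?T (lam i) n)"
  proof (rule linear_system_solvable_in_subfield[OF L])
    show "?T (monom 1 k) n \<in> L" for k n
      using L cof i by (intro apply_shift_in_subfield expol_in_subfield polys_over_monom subfield_closed)
    show "?T (lam i) n \<in> L" if "n \<in> {n0..}" for n
      using that seq unfolding apply_shift_cofactor[OF i(1), symmetric]
      by (intro apply_shift_in_subfield L cof) auto
    show "(\<Sum>k\<le>degree (lam i). ?T (monom 1 k) n * coeff (lam i) k) = ?T (lam i) n" for n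
      unfolding lin[symmetric] by (simp add: smult_monom poly_as_sum_of_monoms)
  qed simp
  then obtain c where c: "\<And>k. k \<le> degree (lam i) \<Longrightarrow> c k \<in> L"
    "\<And>n. n \<ge> n0 \<Longrightarrow> (\<Sum>k\<le>degree (lam i). ?T (monom 1 k) n * c k) = ?T (lam i) n" by auto
  have "lam i = (\<Sum>k\<le>degree (lam i). smult (c k) (monom 1 k))"
    by (rule apply_shift_expol_eq_imp[OF base_nz[OF i(1)] cofactor_nz[OF i(1)], of n0])
      (simp only: lin c(2))
  also have "\<dots> \<in> polys_over L"
    using L c(1) by (intro polys_over_sum polys_over_smult polys_over_monom subfield_closed) auto
  finally show "lam i \<in> polys_over L" .
qed

end

locale exponential_sum_over = exponential_sum A \<alpha> lam
  for A :: "'i set" and \<alpha> :: "'i \<Rightarrow> 'a::field_char_0" and lam +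
  fixes F :: "'a set" and n0 :: int
  assumes F: "is_subfield F" and eventually_in: "n \<ge> n0 \<Longrightarrow> seq n \<in> F"
begin

text \<open>Being the only monic annihilator of its degree, \<open>ann\<close> has as coefficients the unique solution of a
linear system with entries in \<open>F\<close>.\<close>

lemma ann_over_subfield: "ann \<in> polys_over F"
proof -
  define D where "D = degree ann"
  have shift: "apply_shift p seq n = (\<Sum>k<D. seq (n + int k) * coeff p k) + seq (n + int D)"
    if "degree p = D" "lead_coeff p = 1" for p n
    using that by (simp add: apply_shift_def lessThan_Suc_atMost[symmetric] mult.commute)
  have "\<exists>c. (\<forall>k\<in>{..<D}. c k \<in> F) \<and>
      (\<forall>n\<in>{n0..}. (\<Sum>k<D. seq (n + int k) * c k) = - seq (n + int D))"
  proof (rule linear_system_solvable_in_subfield[OF F])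
    show "(\<Sum>k<D. seq (n + int k) * coeff ann k) = - seq (n + int D)" for n
      using shift[of ann n] ann_monic by (simp add: D_def apply_shift_ann eq_neg_iff_add_eq_0)
  qed (use F in \<open>auto intro!: subfield_closed eventually_in\<close>)
  then obtain c where c: "\<And>k. k < D \<Longrightarrow> c k \<in> F"
    "\<And>n. n \<ge> n0 \<Longrightarrow> (\<Sum>k<D. seq (n + int k) * c k) = - seq (n + int D)" by auto
  define p where "p = (\<Sum>k<D. monom (c k) k) + monom 1 D"
  have coeff_p: "coeff p k = (if k < D then c k else if k = D then 1 else 0)" for k
    by (auto simp: p_def coeff_sum)
  have deg: "degree p = D"
    by (intro antisym degree_le le_degree) (auto simp: coeff_p)
  have p: "p \<in> polys_over F" using F c by (auto intro!: polys_overI subfield_closed simp: coeff_p)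
  have "apply_shift p seq n = 0" if "n \<ge> n0" for n
    using shift[OF deg, of n] c(2)[OF that] by (simp add: deg coeff_p)
  then have "ann dvd p" by (rule ann_dvd_annihilator)
  then obtain q where q: "p = ann * q" by (elim dvdE)
  have "p \<noteq> 0" using coeff_p[of D] by auto
  with q have "degree q = 0" using deg by (auto simp: degree_mult_eq D_def)
  moreover have "lead_coeff q = 1"
    using arg_cong[OF q, of lead_coeff] deg ann_monic by (simp add: lead_coeff_mult coeff_p)
  ultimately have "q = 1" by (auto elim!: degree_eq_zeroE simp: one_pCons)
  with q p show ?thesis by simp
qed

text \<open>The constant coefficient \<open>c\<close> of \<open>ann\<close> is nonzero because no \<open>\<alpha> i\<close> is zero, so the recurrence also
expresses \<open>seq m\<close> through later values.\<close>

lemma seq_in_subfield: "seq n \<in> F"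
proof -
  obtain c q where cq: "ann = pCons c q" by (cases ann)
  have "poly ann 0 \<noteq> 0" using ann_root_iff base_nz by force
  with cq have "c \<noteq> 0" by simp
  have c: "c \<in> F" using polys_overD[OF ann_over_subfield, of 0] by (simp add: cq)
  have q: "q \<in> polys_over F"
    using polys_overD[OF ann_over_subfield, of "Suc k" for k] by (intro polys_overI) (simp add: cq)
  have step: "seq m \<in> F" if "\<And>l. l \<ge> m + 1 \<Longrightarrow> seq l \<in> F" for m
  proof -
    have "seq m = - (apply_shift q seq (m + 1)) / c"
      using apply_shift_ann[of m] \<open>c \<noteq> 0\<close> unfolding cq apply_shift_pCons
      by (simp add: field_simps eq_neg_iff_add_eq_0)
    also have "\<dots> \<in> F" using F q c that by (intro subfield_closed apply_shift_in_subfield) auto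
    finally show ?thesis .
  qed
  have "\<forall>m\<ge>n0 - int k. seq m \<in> F" for k
  proof (induction k)
    case 0
    show ?case using eventually_in by simp
  next
    case (Suc k)
    show ?case
    proof (intro allI impI)
      fix m assume "m \<ge> n0 - int (Suc k)"
      then have "l \<ge> n0 - int k" if "l \<ge> m + 1" for l using that by simp
      with Suc show "seq m \<in> F" by (blast intro: step[of m])
    qed
  qed
  from this[of "nat (n0 - n)"] show ?thesis by auto
qed

text \<open>The map \<open>\<tau>\<close> fixes \<open>ann\<close> and the values of \<open>seq\<close>. It therefore maps the root \<open>\<alpha> i\<close> of \<open>ann\<close> to a root
\<open>\<alpha> j\<close> of the same multiplicity, the cofactor of \<open>i\<close> to that of \<open>j\<close>, and so the \<open>i\<close>-th isolated term to
the \<open>j\<close>-th.\<close>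

lemma embedding_permutes_terms:
  assumes L: "is_subfield L" "F \<subseteq> L" and i: "i \<in> A" "\<alpha> i \<in> L"
    and \<tau>: "field_hom_on L \<tau>" "\<And>x. x \<in> F \<Longrightarrow> \<tau> x = x"
  shows "\<exists>j\<in>A. \<tau> (\<alpha> i) = \<alpha> j \<and> map_poly \<tau> (lam i) = lam j"
proof -
  interpret \<tau>: subfield_hom L \<tau> by standard fact+
  have annL: "ann \<in> polys_over L" using ann_over_subfield polys_over_mono L by blast
  have lam: "lam i \<in> polys_over L" and cof: "cofactor i \<in> polys_over L"
    using lam_over_subfield[OF L(1) annL _ i] L eventually_in by blast+
  have lin: "[:- \<alpha> i, 1:] \<in> polys_over L"
    using polys_over_linear_power[OF L(1) i(2), of 1] by simp
  have fix_ann: "map_poly \<tau> ann = ann"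
    by (intro poly_eqI) (simp add: \<tau>.coeff_map_hom \<tau>(2) polys_overD[OF ann_over_subfield])
  have "map_poly \<tau> ann = map_poly \<tau> ([:- \<alpha> i, 1:] ^ Suc (degree (lam i)) * cofactor i)"
    by (simp only: ann_eq_cofactor[OF i(1), symmetric])
  also have "\<dots> = [:- \<tau> (\<alpha> i), 1:] ^ Suc (degree (lam i)) * map_poly \<tau> (cofactor i)"
    using lin cof L(1)
    by (subst \<tau>.map_hom_mult)
      (auto simp: \<tau>.map_hom_power \<tau>.map_hom_linear i polys_over_power simp del: power_Suc)
  finally have ann_eq: "ann = [:- \<tau> (\<alpha> i), 1:] ^ Suc (degree (lam i)) * map_poly \<tau> (cofactor i)"
    unfolding fix_ann .
  have "poly ann (\<tau> (\<alpha> i)) = 0" by (subst ann_eq) simp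
  then obtain j where j: "j \<in> A" "\<tau> (\<alpha> i) = \<alpha> j" using ann_root_iff by auto
  have cof_nz: "poly (map_poly \<tau> (cofactor i)) (\<alpha> j) \<noteq> 0"
    using \<tau>.poly_map_hom[OF cof i(2)] cofactor_nz[OF i(1)] \<tau>.hom_eq_0_iff i(2) cof L(1)
    by (simp add: j(2) poly_in_subfield)
  have order: "order (\<alpha> j) ([:- \<alpha> j, 1:] ^ Suc e * g) = Suc e"
    if "poly g (\<alpha> j) \<noteq> 0" for e and g :: "'a poly"
  proof -
    have "g \<noteq> 0" using that by auto
    then show ?thesis using that
      by (subst order_mult) (auto simp: order_power_n_n order_0I simp del: power_Suc)
  qed
  have "Suc (degree (lam i)) = Suc (degree (lam j))"
    using order[OF cof_nz, of "degree (lam i)"] order[OF cofactor_nz[OF j(1)], of "degree (lam j)"]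
    unfolding ann_eq_cofactor[OF j(1), symmetric] ann_eq[unfolded j(2), symmetric] by simp
  then have cof_j: "map_poly \<tau> (cofactor i) = cofactor j"
    using ann_eq[unfolded j(2)] ann_eq_cofactor[OF j(1)]
    by (metis mult_left_cancel pCons_eq_0_iff power_not_zero one_neq_zero)
  have "map_poly \<tau> (lam i) = lam j"
  proof (rule apply_shift_expol_eq_imp[OF base_nz[OF j(1)] cofactor_nz[OF j(1)], of n0])
    fix n
    have in_L: "seq m \<in> L" for m using seq_in_subfield L by blast
    have "apply_shift (cofactor j) (expol (\<alpha> j) (map_poly \<tau> (lam i))) n
        = \<tau> (apply_shift (cofactor i) (expol (\<alpha> i) (lam i)) n)"
      using hom_expol[OF L(1) \<tau>(1) i(2) lam] expol_in_subfield[OF L(1) i(2) lam]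
      by (subst hom_apply_shift[OF L(1) \<tau>(1) cof]) (simp_all add: cof_j j(2))
    also have "\<dots> = \<tau> (apply_shift (cofactor i) seq n)"
      by (simp only: apply_shift_cofactor[OF i(1)])
    also have "\<dots> = apply_shift (cofactor j) seq n"
      using in_L \<tau>(2)[OF seq_in_subfield]
      by (subst hom_apply_shift[OF L(1) \<tau>(1) cof]) (simp_all add: cof_j)
    finally show "apply_shift (cofactor j) (expol (\<alpha> j) (map_poly \<tau> (lam i))) n
        = apply_shift (cofactor j) (expol (\<alpha> j) (lam j)) n"
      by (simp only: apply_shift_cofactor[OF j(1)])
  qed
  with j show ?thesis by blast
qed

lemma coeffs_in_adjoin_base:
  assumes i: "i \<in> A"
  shows "adjoin_coeffs F (lam i) \<subseteq> adjoin F {\<alpha> i}"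
proof -
  have "lam i \<in> polys_over (adjoin F {\<alpha> i})"
    using adjoin_base[of F "{\<alpha> i}"] adjoin_gens[of "{\<alpha> i}" F] ann_over_subfield seq_in_subfield
    by (intro lam_over_subfield[OF is_subfield_adjoin _ _ i]) (auto intro: polys_over_mono)
  then show ?thesis unfolding adjoin_coeffs_def
    using adjoin_base[of F "{\<alpha> i}"]
    by (intro adjoin_least is_subfield_adjoin) (auto dest: polys_overD)
qed

text \<open>An embedding that fixes \<open>lam i\<close> and moves \<open>\<alpha> i\<close> to \<open>\<alpha> j\<close> forces \<open>lam j = lam i\<close>.\<close>

lemma base_in_adjoin_coeffs:
  assumes "inj_on lam A" and i: "i \<in> A"
  shows "\<alpha> i \<in> adjoin_coeffs F (lam i)"
proof (rule ccontr)
  let ?M = "adjoin_coeffs F (lam i)" and ?L = "adjoin (adjoin_coeffs F (lam i)) {\<alpha> i}"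
  assume notin: "\<alpha> i \<notin> ?M"
  have M: "is_subfield ?M" and FM: "F \<subseteq> ?M" and coeffs: "range (coeff (lam i)) \<subseteq> ?M"
    unfolding adjoin_coeffs_def by (rule is_subfield_adjoin adjoin_base adjoin_gens)+
  have "ann \<in> polys_over ?M" using ann_over_subfield polys_over_mono[OF FM] by blast
  moreover have "poly ann (\<alpha> i) = 0" using i by (simp add: ann_root_iff)
  ultimately obtain \<tau> where \<tau>: "field_hom_on ?L \<tau>" "\<And>x. x \<in> ?M \<Longrightarrow> \<tau> x = x" "\<tau> (\<alpha> i) \<noteq> \<alpha> i"
    using nontrivial_embedding[OF M notin finite_A, of \<alpha> "\<lambda>i. Suc (degree (lam i))", folded ann_def]
    by blast
  interpret \<tau>: subfield_hom ?L \<tau> by standard (rule is_subfield_adjoin \<tau>)+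
  have "F \<subseteq> ?L" using FM adjoin_base by blast
  then obtain j where j: "j \<in> A" "\<tau> (\<alpha> i) = \<alpha> j" "map_poly \<tau> (lam i) = lam j"
    using embedding_permutes_terms[OF is_subfield_adjoin _ i _ \<tau>(1)] adjoin_gens[of "{\<alpha> i}" ?M] \<tau>(2) FM
    by blast
  have "map_poly \<tau> (lam i) = lam i"
    using coeffs by (intro poly_eqI) (auto simp: \<tau>.coeff_map_hom intro!: \<tau>(2))
  with j assms have "j = i" by (auto simp: inj_on_def)
  with j \<tau>(3) show False by simp
qed

text \<open>A combination of shifts of \<open>seq\<close> with constant coefficients is again bounded, and \<open>p\<close> is chosen so
that this combination is \<open>c * \<alpha> i powi n\<close> with \<open>c \<noteq> 0\<close>. The axioms for \<open>W\<close> are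
relative to \<open>L\<close>, because the absolute value that \<open>\<iota>\<close> transports to \<open>K\<close> lives on its image.\<close>

lemma bounded_imp_base_le_1:
  fixes W :: "'a \<Rightarrow> real"
  assumes L: "is_subfield L" "F \<subseteq> L" and i: "i \<in> A" "\<alpha> i \<in> L"
    and W_nonneg: "\<And>x. x \<in> L \<Longrightarrow> W x \<ge> 0" and W_zero: "\<And>x. x \<in> L \<Longrightarrow> W x = 0 \<longleftrightarrow> x = 0"
    and W_mult: "\<And>x y. x \<in> L \<Longrightarrow> y \<in> L \<Longrightarrow> W (x * y) = W x * W y"
    and W_add: "\<And>x y. x \<in> L \<Longrightarrow> y \<in> L \<Longrightarrow> W (x + y) \<le> W x + W y"
    and bounded: "\<And>n. n \<ge> N \<Longrightarrow> W (seq n) \<le> C"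
  shows "W (\<alpha> i) \<le> 1"
proof (rule ccontr)
  assume gt: "\<not> ?thesis"
  have in_L: "seq m \<in> L" for m using seq_in_subfield L by blast
  have annL: "ann \<in> polys_over L" using ann_over_subfield polys_over_mono L by blast
  have cof: "cofactor i \<in> polys_over L" using lam_over_subfield[OF L(1) annL in_L i] by blast
  define p where "p = cofactor i * [:- \<alpha> i, 1:] ^ degree (lam i)"
  have p: "p \<in> polys_over L" unfolding p_def using L i cof
    by (intro polys_over_mult polys_over_linear_power)
  obtain c where c: "c \<noteq> 0" "apply_shift p seq = expol (\<alpha> i) [:c:]"
  proof -
    obtain c where c: "c \<noteq> 0"
      "apply_shift ([:- \<alpha> i, 1:] ^ degree (lam i)) (expol (\<alpha> i) (lam i)) = expol (\<alpha> i) [:c:]"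
      using apply_shift_difference_power_degree[OF base_nz[OF i(1)] lam_nz[OF i(1)]] by blast
    obtain \<nu> where \<nu>: "apply_shift (cofactor i) (expol (\<alpha> i) [:c:]) = expol (\<alpha> i) \<nu>"
      "degree \<nu> \<le> degree [:c:]" "coeff \<nu> (degree [:c:]) = poly (cofactor i) (\<alpha> i) * lead_coeff [:c:]"
      using apply_shift_expol[OF base_nz[OF i(1)]] by blast
    then obtain e where e: "\<nu> = [:e:]" by (auto elim: degree_eq_zeroE)
    have "apply_shift p seq = expol (\<alpha> i) [:e:]"
      unfolding p_def mult.commute[of "cofactor i"] apply_shift_mult apply_shift_cofactor[OF i(1)]
      unfolding apply_shift_mult[symmetric] mult.commute[of _ "cofactor i"]
      unfolding apply_shift_mult c(2) \<nu>(1) e ..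
    moreover have "e \<noteq> 0" using \<nu>(3) c(1) cofactor_nz[OF i(1)] by (simp add: e)
    ultimately show ?thesis using that by blast
  qed
  have W1: "W 1 = 1" using W_mult[of 1 1] W_zero[of 1] L by (auto simp: subfield_closed)
  have W_power: "W (x ^ n) = W x ^ n" if "x \<in> L" for x n
    using that L by (induction n) (auto simp: W1 W_mult subfield_closed)
  have W_sum: "W (sum f B) \<le> (\<Sum>b\<in>B. W (f b))" if "\<And>b. b \<in> B \<Longrightarrow> f b \<in> L" for f and B :: "nat set"
    using that
  proof (induction B rule: infinite_finite_induct)
    case (insert b B)
    then have "W (f b + sum f B) \<le> W (f b) + W (sum f B)"
      using L by (intro W_add) (auto intro: subfield_closed)
    with insert show ?case by auto
  qed (use W_zero[of 0] L in \<open>auto simp: subfield_closed\<close>)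
  have bound: "W (apply_shift p seq n) \<le> (\<Sum>k\<le>degree p. W (coeff p k) * C)" if "n \<ge> N" for n
  proof -
    have "W (apply_shift p seq n) \<le> (\<Sum>k\<le>degree p. W (coeff p k * seq (n + int k)))"
      unfolding apply_shift_def using p in_L L by (intro W_sum subfield_closed) (auto dest: polys_overD)
    also have "\<dots> \<le> (\<Sum>k\<le>degree p. W (coeff p k) * C)"
      using p in_L that
      by (intro sum_mono) (auto simp: W_mult polys_overD intro!: mult_left_mono bounded W_nonneg)
    finally show ?thesis .
  qed
  have pure_power: "apply_shift p seq (int n) = c * \<alpha> i ^ n" for n by (simp add: c expol_def)
  have "apply_shift p seq (int 0) \<in> L" by (rule apply_shift_in_subfield[OF L(1) p in_L])
  then have cL: "c \<in> L" unfolding pure_power by simp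
  have Wc: "W c > 0" using W_nonneg[OF cL] W_zero[OF cL] c by auto
  obtain n where n: "(\<Sum>k\<le>degree p. W (coeff p k) * C) / W c < W (\<alpha> i) ^ n"
    using real_arch_pow gt by (meson not_le)
  also have "W (\<alpha> i) ^ n \<le> W (\<alpha> i) ^ (n + nat N)" using gt by (intro power_increasing) auto
  finally have "(\<Sum>k\<le>degree p. W (coeff p k) * C) < W c * W (\<alpha> i) ^ (n + nat N)"
    using Wc by (simp add: field_simps)
  also have "\<dots> = W (apply_shift p seq (int (n + nat N)))"
    unfolding pure_power using i L cL by (simp add: W_mult W_power subfield_closed)
  also have "\<dots> \<le> (\<Sum>k\<le>degree p. W (coeff p k) * C)" by (intro bound) auto
  finally show False by simp
qed

end

section \<open>Transfer along an embedding of an algebraic closure\<close>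

text \<open>Over \<open>'c\<close> the polynomial \<open>f\<close> splits into linear factors with algebraic roots \<open>r\<close>, and \<open>\<iota>\<close> carries this
factorization to one of \<open>map_poly \<iota> f\<close> with the roots \<open>\<iota> r\<close>.\<close>

lemma roots_of_mapped_poly:
  fixes f :: "'c::alg_closed_field poly" and \<iota> :: "'c \<Rightarrow> 'k::field"
  assumes k: "is_subfield k" and \<iota>: "field_hom_on (algebraic_elements k) \<iota>"
    and f: "f \<in> polys_over k" "f \<noteq> 0" and root: "poly (map_poly \<iota> f) x = 0"
  shows "x \<in> \<iota> ` algebraic_elements k"
proof -
  let ?B = "algebraic_elements k"
  have B: "is_subfield ?B" by (rule is_subfield_algebraic_elements[OF k])
  interpret subfield_hom ?B \<iota> by standard fact+
  obtain R where R: "f = smult (lead_coeff f) (\<Prod>r\<in>#R. [:- r, 1:])"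
    using alg_closed_imp_factorization[OF f(2)] by blast
  define g where "g = (\<Prod>r\<in>#R. [:- r, 1:])"
  have fg: "f = [:lead_coeff f:] * g" using R by (simp add: g_def)
  have "r \<in> ?B" if "r \<in># R" for r
  proof -
    from that have "poly f r = 0" by (subst R) (auto simp: poly_prod_mset prod_mset_zero_iff)
    with f show ?thesis by (auto simp: algebraic_elements_def)
  qed
  then have g: "g \<in> polys_over ?B \<and> map_poly \<iota> g = (\<Prod>r\<in>#R. [:- \<iota> r, 1:])"
    unfolding g_def
  proof (induction R)
    case empty
    then show ?case using B by (simp add: polys_over_1 map_poly_1' hom_one)
  next
    case (add r R)
    have "[:- r, 1:] \<in> polys_over ?B"
      using polys_over_linear_power[OF B, of r 1] add.prems by simp
    with add B show ?case by (auto simp: polys_over_mult map_hom_mult map_hom_linear simp del: mult_pCons_left)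
  qed
  have lc: "lead_coeff f \<in> ?B" using f subfield_elem_algebraic[OF k] by (auto dest: polys_overD)
  have "map_poly \<iota> f = map_poly \<iota> [:lead_coeff f:] * (\<Prod>r\<in>#R. [:- \<iota> r, 1:])"
    using g lc B by (subst fg) (auto simp: map_hom_mult polys_over_pCons polys_over_0 simp del: mult_pCons_left)
  also have "map_poly \<iota> [:lead_coeff f:] = [:\<iota> (lead_coeff f):]" by (simp add: map_hom_pCons)
  finally have "\<iota> (lead_coeff f) * poly (\<Prod>r\<in>#R. [:- \<iota> r, 1:]) x = 0" using root by simp
  moreover have "\<iota> (lead_coeff f) \<noteq> 0" using lc f hom_eq_0_iff by simp
  ultimately obtain r where "r \<in># R" "x = \<iota> r"
    by (auto simp: poly_prod_mset prod_mset_zero_iff)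
  then show ?thesis using \<open>\<And>r. r \<in># R \<Longrightarrow> r \<in> ?B\<close> by blast
qed

theorem theorem4p2:
  fixes k kv k' k'bar :: "'c::{alg_closed_field,field_char_0} set"
    and v :: "'c \<Rightarrow> real"
    and \<gamma> :: 'c
    and \<iota> :: "'c \<Rightarrow> 'K::field_char_0"
    and m :: nat
    and lam :: "nat \<Rightarrow> 'K poly"
    and \<alpha> :: "nat \<Rightarrow> 'K"
    and S :: "int \<Rightarrow> 'K"
    and n\<^sub>0 :: int
  assumes setting: "completion_setting k v kv"
    and k': "is_subfield k'" "k' \<subseteq> adjoin kv {\<gamma>}"
    and k'bar: "k'bar = algebraic_elements k'"
    and K: "field_hom_on k'bar \<iota>"
    and lam: "\<And>i. i \<in> {1..m} \<Longrightarrow> lam i \<noteq> 0"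
    and \<alpha>: "\<And>i. i \<in> {1..m} \<Longrightarrow> \<alpha> i \<noteq> 0" "inj_on \<alpha> {1..m}"
    and S: "\<And>n. S n = (\<Sum>i=1..m. poly (lam i) (of_int n) * \<alpha> i powi n)"
    and S_in: "\<And>n. n \<ge> n\<^sub>0 \<Longrightarrow> S n \<in> \<iota> ` k'"
  shows "(\<forall>n. S n \<in> \<iota> ` k')
    \<and> \<comment> \<open>(i)\<close>
      (\<exists>f\<in>polys_over k'. f \<noteq> 0 \<and> {x. poly (map_poly \<iota> f) x = 0} = \<alpha> ` {1..m})
    \<and> (\<forall>i\<in>{1..m}. \<alpha> i \<in> \<iota> ` k'bar)
    \<and> ((\<lambda>n. v (inv_into k'bar \<iota> (S n))) \<in> O[at_top](\<lambda>_. 1) \<longrightarrow>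
         (\<forall>i\<in>{1..m}. v (inv_into k'bar \<iota> (\<alpha> i)) \<le> 1))
    \<and> \<comment> \<open>(ii)\<close>
      (\<forall>i\<in>{1..m}. adjoin_coeffs (\<iota> ` k') (lam i) \<subseteq> adjoin (\<iota> ` k') {\<alpha> i})
    \<and> \<comment> \<open>(iii)\<close>
      (\<forall>\<sigma> \<in> Gal (adjoin (\<iota> ` k') (\<alpha> ` {1..m})) (\<iota> ` k'). \<forall>\<pi>. \<pi> permutes {1..m} \<longrightarrow>
         (\<forall>i\<in>{1..m}. \<sigma> (\<alpha> i) = \<alpha> (\<pi> i)) \<longrightarrow>
         (\<forall>i\<in>{1..m}. map_poly \<sigma> (lam i) = lam (\<pi> i)))
    \<and> \<comment> \<open>(iv)\<close>
      (inj_on lam {1..m} \<longrightarrow>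
         (\<forall>i\<in>{1..m}. adjoin (\<iota> ` k') {\<alpha> i} = adjoin_coeffs (\<iota> ` k') (lam i)))"
proof -
  let ?F = "\<iota> ` k'" and ?L = "\<iota> ` k'bar"
  have B: "is_subfield k'bar" unfolding k'bar by (rule is_subfield_algebraic_elements[OF k'(1)])
  interpret \<iota>: subfield_hom k'bar \<iota> by standard fact+
  have kB: "k' \<subseteq> k'bar" using subfield_elem_algebraic[OF k'(1)] by (auto simp: k'bar)
  have F: "is_subfield ?F" by (rule \<iota>.is_subfield_image[OF k'(1) kB])
  have L: "is_subfield ?L" by (rule \<iota>.is_subfield_image[OF B order_refl])
  have FL: "?F \<subseteq> ?L" using kB by (rule image_mono)
  interpret exponential_sum "{1..m}" \<alpha> lam
    by standard (use \<alpha> lam in auto)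
  have S_eq: "S n = seq n" for n unfolding seq_def expol_def S ..
  interpret exponential_sum_over "{1..m}" \<alpha> lam ?F n\<^sub>0
    by standard (use F S_in in \<open>simp_all only: S_eq\<close>)

  have in_F: "\<forall>n. S n \<in> ?F" using seq_in_subfield by (simp add: S_eq)

  obtain f where f: "f \<in> polys_over k'" "map_poly \<iota> f = ann"
  proof
    have "inv_into k' \<iota> (coeff ann i) \<in> k'" for i
      using polys_overD[OF ann_over_subfield] by (rule inv_into_into)
    moreover have inv0: "inv_into k' \<iota> 0 = 0"
      using inv_into_f_f[OF inj_on_subset[OF \<iota>.hom_inj kB], of 0] k'(1)
      by (simp add: \<iota>.hom_zero subfield_closed)
    ultimately show "map_poly (inv_into k' \<iota>) ann \<in> polys_over k'"
      by (intro polys_overI) (simp add: coeff_map_poly)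
    show "map_poly \<iota> (map_poly (inv_into k' \<iota>) ann) = ann"
      using inv0 polys_overD[OF ann_over_subfield]
      by (intro poly_eqI) (simp add: \<iota>.coeff_map_hom coeff_map_poly f_inv_into_f)
  qed
  have "f \<noteq> 0" using f(2) ann_nz by auto
  moreover have roots: "{x. poly (map_poly \<iota> f) x = 0} = \<alpha> ` {1..m}"
    using ann_root_iff f(2) by auto
  ultimately have i_poly: "\<exists>f\<in>polys_over k'. f \<noteq> 0 \<and> {x. poly (map_poly \<iota> f) x = 0} = \<alpha> ` {1..m}"
    using f(1) by blast

  have i_algebraic: "\<forall>i\<in>{1..m}. \<alpha> i \<in> ?L"
  proof
    fix i assume "i \<in> {1..m}"
    then have "poly (map_poly \<iota> f) (\<alpha> i) = 0" using roots by blast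
    then show "\<alpha> i \<in> ?L" unfolding k'bar
      using roots_of_mapped_poly[OF k'(1) K[unfolded k'bar] f(1) \<open>f \<noteq> 0\<close>] by blast
  qed

  have i_bounded: "(\<lambda>n. v (inv_into k'bar \<iota> (S n))) \<in> O[at_top](\<lambda>_. 1) \<longrightarrow>
      (\<forall>i\<in>{1..m}. v (inv_into k'bar \<iota> (\<alpha> i)) \<le> 1)"
  proof (intro impI ballI)
    let ?W = "\<lambda>x. v (inv_into k'bar \<iota> x)"
    fix i assume i: "i \<in> {1..m}"
    assume "(\<lambda>n. ?W (S n)) \<in> O[at_top](\<lambda>_. 1)"
    then obtain C where "eventually (\<lambda>n. norm (?W (S n)) \<le> C * norm (1 :: real)) at_top"
      by (elim landau_o.bigE)
    then obtain N where N: "\<And>n. n \<ge> N \<Longrightarrow> ?W (seq n) \<le> C"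
      unfolding eventually_at_top_linorder S_eq by force
    have v: "v x \<ge> 0" "v x = 0 \<longleftrightarrow> x = 0" "v (x * y) = v x * v y" "v (x + y) \<le> v x + v y" for x y
      using setting by (auto simp: completion_setting_def absolute_value_def)
    have inv: "inv_into k'bar \<iota> (\<iota> x) = x" if "x \<in> k'bar" for x
      by (rule inv_into_f_f[OF \<iota>.hom_inj that])
    show "?W (\<alpha> i) \<le> 1"
    proof (rule bounded_imp_base_le_1[where W = ?W, OF L FL i _ _ _ _ _ N])
      show "\<alpha> i \<in> ?L" using i_algebraic i by blast
      show "?W x \<ge> 0" for x by (rule v)
      show "?W x = 0 \<longleftrightarrow> x = 0" if "x \<in> ?L" for x
        using that inv v(2) \<iota>.hom_eq_0_iff by auto
      show "?W (x * y) = ?W x * ?W y" "?W (x + y) \<le> ?W x + ?W y" if xy: "x \<in> ?L" "y \<in> ?L" for x y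
      proof -
        obtain a b where "a \<in> k'bar" "b \<in> k'bar" "x = \<iota> a" "y = \<iota> b" using xy by blast
        with B show "?W (x * y) = ?W x * ?W y" "?W (x + y) \<le> ?W x + ?W y"
          by (simp_all add: inv v subfield_closed \<iota>.hom_mult[symmetric] \<iota>.hom_add[symmetric])
      qed
    qed
  qed

  have iii: "\<forall>\<sigma> \<in> Gal (adjoin ?F (\<alpha> ` {1..m})) ?F. \<forall>\<pi>. \<pi> permutes {1..m} \<longrightarrow>
      (\<forall>i\<in>{1..m}. \<sigma> (\<alpha> i) = \<alpha> (\<pi> i)) \<longrightarrow> (\<forall>i\<in>{1..m}. map_poly \<sigma> (lam i) = lam (\<pi> i))"
  proof (intro ballI allI impI)
    fix \<sigma> \<pi> i
    assume \<sigma>: "\<sigma> \<in> Gal (adjoin ?F (\<alpha> ` {1..m})) ?F" and \<pi>: "\<pi> permutes {1..m}"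
      and act: "\<forall>i\<in>{1..m}. \<sigma> (\<alpha> i) = \<alpha> (\<pi> i)" and i: "i \<in> {1..m}"
    have "\<alpha> i \<in> adjoin ?F (\<alpha> ` {1..m})" using i adjoin_gens by blast
    with \<sigma> obtain j where j: "j \<in> {1..m}" "\<sigma> (\<alpha> i) = \<alpha> j" "map_poly \<sigma> (lam i) = lam j"
      using embedding_permutes_terms[OF is_subfield_adjoin adjoin_base i, of "\<alpha> ` {1..m}" \<sigma>]
      unfolding Gal_def by blast
    have "\<pi> i \<in> {1..m}" using \<pi> i by (simp only: permutes_in_image)
    with j act i inj have "j = \<pi> i" by (auto dest: inj_onD)
    with j show "map_poly \<sigma> (lam i) = lam (\<pi> i)" by simp
  qed

  have iv: "inj_on lam {1..m} \<longrightarrow>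
      (\<forall>i\<in>{1..m}. adjoin ?F {\<alpha> i} = adjoin_coeffs ?F (lam i))"
  proof (intro impI ballI equalityI coeffs_in_adjoin_base)
    fix i assume "inj_on lam {1..m}" "i \<in> {1..m}"
    then have "\<alpha> i \<in> adjoin_coeffs ?F (lam i)" by (rule base_in_adjoin_coeffs)
    then show "adjoin ?F {\<alpha> i} \<subseteq> adjoin_coeffs ?F (lam i)"
      unfolding adjoin_coeffs_def
      by (intro adjoin_least is_subfield_adjoin adjoin_base) simp
  qed

  from in_F i_poly i_algebraic i_bounded coeffs_in_adjoin_base iii iv show ?thesis by blast
qed

end
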